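(* Let $\mathcal X$ be an infinite dimensional complex Banach space and let $A\in B(\mathcal X)$ be arbitrary. Let $L_A,R_A\in B(B(\mathcal X))$ be the operators $L_A(T)=AT$, $R_A(T)=TA$. Then Browder's theorem holds for $L_A$ and for $R_A$. Also (i) $\sigma_{BW}(A)\subseteq \sigma_{BW}(L_A)=\sigma_{DR}(L_A)=\sigma_{DR}(A)$, and (ii) $\sigma_{BW}(A)\subseteq \sigma_{BW}(R_A)=\sigma_{DR}(R_A)=\sigma_{DR}(A)$. Furthermore, each of the following is equivalent to Browder's theorem holding for $A$: (iii) $\sigma_{BW}(L_A)=\sigma_{BW}(A)$; (iv) $\sigma_{BW}(R_A)=\sigma_{BW}(A)$.
   Context: For a complex Banach space $\mathcal Z$, $B(\mathcal Z)$ is the Banach algebra of bounded linear operators on $\mathcal Z$. For $T\in B(\mathcal Z)$, $N(T)$, $R(T)$ and $\sigma(T)$ are the null space, range and spectrum; $T-\lambda$ means $T-\lambda I$; $\alpha(T)=\dim N(T)$, $\beta(T)=\dim \mathcal Z/R(T)$. $T$ is Fredholm if $\alpha(T),\beta(T)<\infty$, with index $\mathrm{ind}(T)=\alpha(T)-\beta(T)$; $T$ is Weyl if it is Fredholm of index $0$; $\sigma_w(T)=\{\lambda\in\mathbb C: T-\lambda \text{ is not Weyl}\}$. The ascent $\mathrm{asc}(T)$ (resp. descent $\mathrm{dsc}(T)$) is the smallest non-negative integer $n$ with $N(T^n)=N(T^{n+1})$ (resp. $R(T^n)=R(T^{n+1})$), or $\infty$ if none exists. $\Pi(T)=\{\lambda\in\mathbb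 C: \mathrm{asc}(T-\lambda)=\mathrm{dsc}(T-\lambda)<\infty\}$ and $\Pi_0(T)=\{\lambda\in\Pi(T):\alpha(T-\lambda)<\infty\}$. Browder's theorem holds for $T$ if $\sigma_w(T)=\sigma(T)\setminus\Pi_0(T)$. $T$ is B-Fredholm if for some $n\in\mathbb N$ the range $R(T^n)$ is closed and the induced operator $T_n=T|_{R(T^n)}\in B(R(T^n))$ is Fredholm; its index is $\mathrm{ind}(T)=\mathrm{ind}(T_n)$ (independent of such $n$). $T$ is B-Weyl if it is B-Fredholm of index $0$; $\sigma_{BW}(T)=\{\lambda\in\mathbb C: T-\lambda\text{ is not B-Weyl}\}$. $T$ is Drazin invertible if there exist $S\in B(\mathcal Z)$ and $m\in\mathbb N$ with $T^m=T^mST$, $STS=S$, $TS=ST$; $\sigma_{DR}(T)=\{\lambda\in\mathbb C: T-\lambda\text{ is not Drazin invertible}\}$. *)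

theory Defs
  imports "HOL-Analysis.Analysis" "HOL-Library.Extended_Nat"
begin

section \<open>Complex normed and Banach spaces\<close>

class scaleC =
  fixes scaleC :: "complex \<Rightarrow> 'a \<Rightarrow> 'a"  (infixr \<open>*\<^sub>C\<close> 75)

class complex_normed_vector = real_normed_vector + scaleC +
  assumes scaleC_add_right: "c *\<^sub>C (x + y) = c *\<^sub>C x + c *\<^sub>C y"
    and scaleC_add_left: "(c + d) *\<^sub>C x = c *\<^sub>C x + d *\<^sub>C x"
    and scaleC_scaleC: "c *\<^sub>C d *\<^sub>C x = (c * d) *\<^sub>C x"
    and scaleC_one: "1 *\<^sub>C x = x"
    and scaleR_scaleC: "r *\<^sub>R x = complex_of_real r *\<^sub>C x"
    and norm_scaleC: "norm (c *\<^sub>C x) = cmod c * norm x"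

class complex_banach = complex_normed_vector + complete_space
begin
subclass banach ..
end

interpretation complex_vector: vector_space
  "scaleC :: complex \<Rightarrow> 'a \<Rightarrow> 'a::complex_normed_vector"
  by standard (simp_all add: scaleC_add_right scaleC_add_left scaleC_scaleC scaleC_one)

text \<open>
  Dimension of a complex linear subspace \<open>V\<close>, and of the quotient \<open>V / W\<close> for subspaces
  \<open>W \<subseteq> V\<close>, as the cardinality of a finite basis, and \<open>\<infinity>\<close> (the infimum of the empty set)
  if there is none. As quotients by a variable subspace are not types, a basis of \<open>V / W\<close>
  is given by a set \<open>B\<close> of representatives, whose cosets span \<open>V / W\<close> and are linearly
  independent there.
\<close>

definition cdim :: "'a::complex_normed_vector set \<Rightarrow> enat" where
  "cdim V = (INF B \<in> {B. finite B \<and> complex_vector.independent B \<and> complex_vector.span B = V}.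
     enat (card B))"

definition quotient_basis :: "'a::complex_normed_vector set \<Rightarrow> 'a set \<Rightarrow> 'a set \<Rightarrow> bool" where
  "quotient_basis V W B \<longleftrightarrow>
     finite B \<and> B \<subseteq> V \<and>
     (\<forall>x\<in>V. \<exists>c. x - (\<Sum>b\<in>B. c b *\<^sub>C b) \<in> W) \<and>
     (\<forall>c. (\<Sum>b\<in>B. c b *\<^sub>C b) \<in> W \<longrightarrow> (\<forall>b\<in>B. c b = 0))"

definition quotient_cdim :: "'a::complex_normed_vector set \<Rightarrow> 'a set \<Rightarrow> enat" where
  "quotient_cdim V W = (INF B \<in> {B. quotient_basis V W B}. enat (card B))"


section \<open>The Banach algebra of bounded operators\<close>

definition bounded_clinear ::
    "('a::complex_normed_vector \<Rightarrow> 'b::complex_normed_vector) \<Rightarrow> bool" where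
  "bounded_clinear f \<longleftrightarrow> bounded_linear f \<and> (\<forall>c x. f (c *\<^sub>C x) = c *\<^sub>C f x)"

typedef (overloaded) 'a bop = "{f :: 'a::complex_normed_vector \<Rightarrow> 'a. bounded_clinear f}"
  morphisms bop_apply Bop
  by (rule exI[of _ "\<lambda>x. x"]) (simp add: bounded_clinear_def)

setup_lifting type_definition_bop

lemma bop_eqI: "(\<And>x. bop_apply S x = bop_apply T x) \<Longrightarrow> S = T"
  by transfer auto

lemma bounded_linear_bop_apply: "bounded_linear (bop_apply T)"
  using bop_apply[of T] by (simp add: bounded_clinear_def)

lemma bop_apply_scaleC: "bop_apply T (c *\<^sub>C x) = c *\<^sub>C bop_apply T x"
  using bop_apply[of T] by (simp add: bounded_clinear_def)

lemma bounded_linear_scaleC: "bounded_linear (\<lambda>x::'a::complex_normed_vector. c *\<^sub>C x)"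
  by (rule bounded_linear_intro[of _ "cmod c"])
     (simp_all add: scaleC_add_right scaleR_scaleC scaleC_scaleC norm_scaleC mult.commute)

lemma scaleC_minus_right: "c *\<^sub>C (- x) = - (c *\<^sub>C (x::'a::complex_normed_vector))"
  by (rule complex_vector.scale_minus_right)

lemma scaleC_diff_right: "c *\<^sub>C (x - y) = c *\<^sub>C x - c *\<^sub>C (y::'a::complex_normed_vector)"
  by (rule complex_vector.scale_right_diff_distrib)

instantiation bop :: (complex_normed_vector) complex_normed_vector
begin

lift_definition norm_bop :: "'a bop \<Rightarrow> real" is onorm .

lift_definition zero_bop :: "'a bop" is "\<lambda>x. 0"
  by (simp add: bounded_clinear_def)

lift_definition plus_bop :: "'a bop \<Rightarrow> 'a bop \<Rightarrow> 'a bop" is "\<lambda>f g x. f x + g x"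
  by (simp add: bounded_clinear_def bounded_linear_add scaleC_add_right)

lift_definition minus_bop :: "'a bop \<Rightarrow> 'a bop \<Rightarrow> 'a bop" is "\<lambda>f g x. f x - g x"
  by (simp add: bounded_clinear_def bounded_linear_sub scaleC_diff_right)

lift_definition uminus_bop :: "'a bop \<Rightarrow> 'a bop" is "\<lambda>f x. - f x"
  by (simp add: bounded_clinear_def bounded_linear_minus scaleC_minus_right)

lift_definition scaleC_bop :: "complex \<Rightarrow> 'a bop \<Rightarrow> 'a bop" is "\<lambda>c f x. c *\<^sub>C f x"
  by (simp add: bounded_clinear_def bounded_linear_compose[OF bounded_linear_scaleC]
      scaleC_scaleC mult.commute)

lift_definition scaleR_bop :: "real \<Rightarrow> 'a bop \<Rightarrow> 'a bop" is "\<lambda>r f x. r *\<^sub>R f x"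
  unfolding bounded_clinear_def
  by (intro conjI allI bounded_linear_compose[OF bounded_linear_scaleR_right])
     (simp_all add: scaleR_scaleC scaleC_scaleC mult.commute)

definition dist_bop :: "'a bop \<Rightarrow> 'a bop \<Rightarrow> real" where
  "dist_bop S T = norm (S - T)"

definition uniformity_bop :: "('a bop \<times> 'a bop) filter" where
  "uniformity_bop = (INF e\<in>{0 <..}. principal {(x, y). dist x y < e})"

definition open_bop :: "'a bop set \<Rightarrow> bool" where
  "open_bop U = (\<forall>x\<in>U. \<forall>\<^sub>F (x', y) in uniformity. x' = x \<longrightarrow> y \<in> U)"

definition sgn_bop :: "'a bop \<Rightarrow> 'a bop" where
  "sgn_bop T = inverse (norm T) *\<^sub>R T"

instance
proof
  fix R S T :: "'a bop" and r s :: real and c d :: complex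
  show "R + S + T = R + (S + T)" "R + S = S + R" "0 + R = R" "- R + R = 0" "R - S = R + - S"
    by (transfer, simp add: algebra_simps)+
  show "r *\<^sub>R (S + T) = r *\<^sub>R S + r *\<^sub>R T" "(r + s) *\<^sub>R T = r *\<^sub>R T + s *\<^sub>R T"
    "r *\<^sub>R s *\<^sub>R T = (r * s) *\<^sub>R T" "1 *\<^sub>R T = T"
    by (transfer, simp add: algebra_simps)+
  show "c *\<^sub>C (S + T) = c *\<^sub>C S + c *\<^sub>C T" "(c + d) *\<^sub>C T = c *\<^sub>C T + d *\<^sub>C T"
    "c *\<^sub>C d *\<^sub>C T = (c * d) *\<^sub>C T" "1 *\<^sub>C T = T"
    by (transfer, simp add: scaleC_add_right scaleC_add_left scaleC_scaleC scaleC_one)+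
  show "r *\<^sub>R T = complex_of_real r *\<^sub>C T"
    by transfer (simp add: scaleR_scaleC)
  show "dist S T = norm (S - T)" by (rule dist_bop_def)
  show "sgn T = inverse (norm T) *\<^sub>R T" by (rule sgn_bop_def)
  show "(uniformity :: ('a bop \<times> 'a bop) filter)
      = (INF e\<in>{0 <..}. principal {(x, y). dist x y < e})"
    by (rule uniformity_bop_def)
  show "open U = (\<forall>x\<in>U. \<forall>\<^sub>F (x', y) in uniformity. x' = x \<longrightarrow> y \<in> U)" for U :: "'a bop set"
    by (rule open_bop_def)
  show "(norm T = 0) = (T = 0)"
    by transfer (auto simp: bounded_clinear_def onorm_eq_0)
  show "norm (S + T) \<le> norm S + norm T"
    by transfer (auto simp: bounded_clinear_def intro: onorm_triangle)
  show norm_scaleR: "norm (r *\<^sub>R T) = \<bar>r\<bar> * norm T" for r :: real and T :: "'a bop"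
    by transfer (auto simp: bounded_clinear_def onorm_scaleR)
  show "norm (c *\<^sub>C T) = cmod c * norm T"
  proof transfer
    fix c :: complex and f :: "'a \<Rightarrow> 'a"
    assume "bounded_clinear f"
    then have "bounded_linear f" by (simp add: bounded_clinear_def)
    have "norm (c *\<^sub>C f x) = norm (cmod c *\<^sub>R f x)" for x
      by (simp add: norm_scaleC)
    then have "onorm (\<lambda>x. c *\<^sub>C f x) = onorm (\<lambda>x. cmod c *\<^sub>R f x)"
      by (simp add: onorm_def)
    also have "\<dots> = cmod c * onorm f"
      using onorm_scaleR[OF \<open>bounded_linear f\<close>] by simp
    finally show "onorm (\<lambda>x. c *\<^sub>C f x) = cmod c * onorm f" .
  qed
qed

end

instance bop :: (complex_banach) complex_banach
proof
  fix X :: "nat \<Rightarrow> 'a bop"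
  assume "Cauchy X"
  define Y where "Y n = Blinfun (bop_apply (X n))" for n
  have Y: "blinfun_apply (Y n) = bop_apply (X n)" for n
    by (simp add: Y_def bounded_linear_Blinfun_apply bounded_linear_bop_apply)
  have "norm (Y m - Y n) = norm (X m - X n)" for m n
    by (simp add: norm_blinfun.rep_eq norm_bop.rep_eq minus_blinfun.rep_eq minus_bop.rep_eq Y)
  with \<open>Cauchy X\<close> have "Cauchy Y"
    by (simp add: Cauchy_iff)
  then obtain G where G: "Y \<longlonglongrightarrow> G"
    using convergent_def Cauchy_convergent_iff by blast
  have G_pt: "(\<lambda>n. bop_apply (X n) x) \<longlonglongrightarrow> blinfun_apply G x" for x
    using blinfun.tendsto[OF G tendsto_const[of x]] by (simp add: Y)
  have "blinfun_apply G (c *\<^sub>C x) = c *\<^sub>C blinfun_apply G x" for c x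
  proof (rule LIMSEQ_unique[OF G_pt])
    show "(\<lambda>n. bop_apply (X n) (c *\<^sub>C x)) \<longlonglongrightarrow> c *\<^sub>C blinfun_apply G x"
      unfolding bop_apply_scaleC
      by (rule bounded_linear.tendsto[OF bounded_linear_scaleC G_pt])
  qed
  then have clin: "bounded_clinear (blinfun_apply G)"
    by (simp add: bounded_clinear_def blinfun.bounded_linear_right)
  have "norm (X n - Bop (blinfun_apply G)) = norm (Y n - G)" for n
    by (simp add: norm_blinfun.rep_eq norm_bop.rep_eq minus_blinfun.rep_eq minus_bop.rep_eq Y
        Bop_inverse clin)
  with G have "X \<longlonglongrightarrow> Bop (blinfun_apply G)"
    by (simp add: LIMSEQ_iff)
  then show "convergent X"
    by (rule convergentI)
qed

instantiation bop :: (complex_normed_vector) "{real_normed_algebra, monoid_mult}"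
begin

lift_definition one_bop :: "'a bop" is "\<lambda>x. x"
  by (simp add: bounded_clinear_def)

lift_definition times_bop :: "'a bop \<Rightarrow> 'a bop \<Rightarrow> 'a bop" is "\<lambda>f g x. f (g x)"
  by (simp add: bounded_clinear_def bounded_linear_compose)

instance
proof
  fix R S T :: "'a bop" and r :: real
  show "R * S * T = R * (S * T)" "1 * T = T" "T * 1 = T"
    by (transfer, simp)+
  show "(R + S) * T = R * T + S * T"
    by transfer simp
  show "R * (S + T) = R * S + R * T"
    by transfer (auto simp: bounded_clinear_def linear_simps)
  show "r *\<^sub>R S * T = r *\<^sub>R (S * T)"
    by transfer simp
  show "S * r *\<^sub>R T = r *\<^sub>R (S * T)"
    by transfer (auto simp: bounded_clinear_def linear_simps)
  show "norm (S * T) \<le> norm S * norm T"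
    by transfer (auto simp: bounded_clinear_def dest: onorm_compose[unfolded o_def])
qed

end

lemma bounded_clinear_times_left: "bounded_clinear (\<lambda>T. A * T)"
  for A :: "'a::complex_normed_vector bop"
  unfolding bounded_clinear_def
  by (auto intro: bounded_linear_mult_right bop_eqI
      simp: times_bop.rep_eq scaleC_bop.rep_eq bop_apply_scaleC)

lemma bounded_clinear_times_right: "bounded_clinear (\<lambda>T. T * A)"
  for A :: "'a::complex_normed_vector bop"
  unfolding bounded_clinear_def
  by (auto intro: bounded_linear_mult_left bop_eqI
      simp: times_bop.rep_eq scaleC_bop.rep_eq)

definition left_mult :: "'a::complex_normed_vector bop \<Rightarrow> 'a bop bop" where
  "left_mult A = Bop (\<lambda>T. A * T)"

definition right_mult :: "'a::complex_normed_vector bop \<Rightarrow> 'a bop bop" where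
  "right_mult A = Bop (\<lambda>T. T * A)"

lemma left_mult_apply [simp]: "bop_apply (left_mult A) T = A * T"
  by (simp add: left_mult_def Bop_inverse bounded_clinear_times_left)

lemma right_mult_apply [simp]: "bop_apply (right_mult A) T = T * A"
  by (simp add: right_mult_def Bop_inverse bounded_clinear_times_right)


section \<open>Spectral theory\<close>

definition null_space :: "'a::complex_normed_vector bop \<Rightarrow> 'a set" where
  "null_space T = {x. bop_apply T x = 0}"

definition op_range :: "'a::complex_normed_vector bop \<Rightarrow> 'a set" where
  "op_range T = range (bop_apply T)"

definition shift :: "'a::complex_normed_vector bop \<Rightarrow> complex \<Rightarrow> 'a bop" where
  "shift T l = T - l *\<^sub>C 1"

definition spectrum :: "'a::complex_normed_vector bop \<Rightarrow> complex set" where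
  "spectrum T = {l. \<not> (\<exists>S. S * shift T l = 1 \<and> shift T l * S = 1)}"

text \<open>
  The Fredholm notions are stated for the operator that \<open>T\<close> induces on a \<open>T\<close>-invariant
  subspace \<open>M\<close>, since \<open>R(T\<^sup>n)\<close> is not a type; its null space is \<open>N(T) \<inter> M\<close> and its range
  is \<open>T(M)\<close>. The operator \<open>T\<close> itself is the case \<open>M = UNIV\<close>.
\<close>

definition alpha_on :: "'a::complex_normed_vector set \<Rightarrow> 'a bop \<Rightarrow> enat" where
  "alpha_on M T = cdim (null_space T \<inter> M)"

definition beta_on :: "'a::complex_normed_vector set \<Rightarrow> 'a bop \<Rightarrow> enat" where
  "beta_on M T = quotient_cdim M (bop_apply T ` M)"

definition fredholm_on :: "'a::complex_normed_vector set \<Rightarrow> 'a bop \<Rightarrow> bool" where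
  "fredholm_on M T \<longleftrightarrow> alpha_on M T < \<infinity> \<and> beta_on M T < \<infinity>"

definition index_on :: "'a::complex_normed_vector set \<Rightarrow> 'a bop \<Rightarrow> int" where
  "index_on M T = int (the_enat (alpha_on M T)) - int (the_enat (beta_on M T))"

abbreviation "alpha T \<equiv> alpha_on UNIV T"
abbreviation "fredholm T \<equiv> fredholm_on UNIV T"
abbreviation "fredholm_index T \<equiv> index_on UNIV T"

definition weyl :: "'a::complex_normed_vector bop \<Rightarrow> bool" where
  "weyl T \<longleftrightarrow> fredholm T \<and> fredholm_index T = 0"

definition weyl_spectrum :: "'a::complex_normed_vector bop \<Rightarrow> complex set" where
  "weyl_spectrum T = {l. \<not> weyl (shift T l)}"

definition ascent :: "'a::complex_normed_vector bop \<Rightarrow> enat" where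
  "ascent T = (INF n \<in> {n. null_space (T ^ n) = null_space (T ^ (n + 1))}. enat n)"

definition descent :: "'a::complex_normed_vector bop \<Rightarrow> enat" where
  "descent T = (INF n \<in> {n. op_range (T ^ n) = op_range (T ^ (n + 1))}. enat n)"

text \<open>
  \<open>\<Pi>(T)\<close> and \<open>\<Pi>\<^sub>0(T)\<close> are not restricted to the spectrum: they contain the resolvent set,
  where ascent and descent are both \<open>0\<close>.
\<close>

definition Pi_set :: "'a::complex_normed_vector bop \<Rightarrow> complex set" where
  "Pi_set T = {l. ascent (shift T l) = descent (shift T l) \<and> ascent (shift T l) < \<infinity>}"

definition Pi0_set :: "'a::complex_normed_vector bop \<Rightarrow> complex set" where
  "Pi0_set T = {l \<in> Pi_set T. alpha (shift T l) < \<infinity>}"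

definition browder_theorem :: "'a::complex_normed_vector bop \<Rightarrow> bool" where
  "browder_theorem T \<longleftrightarrow> weyl_spectrum T = spectrum T - Pi0_set T"

definition b_fredholm_at :: "nat \<Rightarrow> 'a::complex_normed_vector bop \<Rightarrow> bool" where
  "b_fredholm_at n T \<longleftrightarrow> closed (op_range (T ^ n)) \<and> fredholm_on (op_range (T ^ n)) T"

definition b_fredholm :: "'a::complex_normed_vector bop \<Rightarrow> bool" where
  "b_fredholm T \<longleftrightarrow> (\<exists>n. b_fredholm_at n T)"

text \<open>
  The index of the operator induced on \<open>R(T\<^sup>n)\<close> is the same for every \<open>n\<close> with
  \<open>b_fredholm_at n T\<close>, so taking the least one is only a choice of representative.
\<close>

definition b_fredholm_index :: "'a::complex_normed_vector bop \<Rightarrow> int" where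
  "b_fredholm_index T = index_on (op_range (T ^ (LEAST n. b_fredholm_at n T))) T"

definition b_weyl :: "'a::complex_normed_vector bop \<Rightarrow> bool" where
  "b_weyl T \<longleftrightarrow> b_fredholm T \<and> b_fredholm_index T = 0"

definition b_weyl_spectrum :: "'a::complex_normed_vector bop \<Rightarrow> complex set" where
  "b_weyl_spectrum T = {l. \<not> b_weyl (shift T l)}"

definition drazin_invertible :: "'a::complex_normed_vector bop \<Rightarrow> bool" where
  "drazin_invertible T \<longleftrightarrow> (\<exists>S m. T ^ m = T ^ m * S * T \<and> S * T * S = S \<and> T * S = S * T)"

definition drazin_spectrum :: "'a::complex_normed_vector bop \<Rightarrow> complex set" where
  "drazin_spectrum T = {l. \<not> drazin_invertible (shift T l)}"

end

theory Submission
  imports Defs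
begin

text \<open>
  Everything is reduced to one implication between properties of a single operator.  An operator
  is Drazin invertible exactly when, for some \<open>n\<close>, it is bijective on \<open>R(T\<^sup>n)\<close>, which is the same
  as having equal finite ascent and descent (\<open>drazin_invertible_iff_bijective_on\<close>,
  \<open>ascent_eq_descent_iff\<close>).  A Drazin invertible operator is therefore B-Weyl, and it is Weyl as soon
  as its kernel has finite dimension.  Hence Browder's theorem for \<open>T\<close> says precisely that every Weyl
  \<open>T - \<lambda>\<close> is Drazin invertible (\<open>browder_theorem_iff\<close>), and \<open>\<sigma>\<^sub>B\<^sub>W = \<sigma>\<^sub>D\<^sub>R\<close> says the same
  of every B-Weyl \<open>T - \<lambda>\<close>.

  For \<open>L = L\<^sub>A\<close> the space \<open>N(L) \<inter> R(L\<^sup>n)\<close> is a right ideal of \<open>B(X)\<close>, and for \<open>R\<^sub>A\<close> it is a left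
  ideal.  By the Hahn-Banach theorem \<open>B(X)\<close> contains enough rank one operators to make every
  nonzero one-sided ideal infinite dimensional when \<open>X\<close> is.  So if \<open>L\<close> is B-Weyl, the kernel of its
  restriction to \<open>R(L\<^sup>n)\<close> is zero, the cokernel is zero because the index is, and \<open>L\<close> is Drazin
  invertible.  A Drazin inverse of \<open>L\<^sub>A\<close> commutes with all right multiplications, hence is itself a
  left multiplication, so \<open>L\<^sub>A\<close> and \<open>A\<close> are Drazin invertible together; likewise for \<open>R\<^sub>A\<close>.

  It remains to compare \<open>\<sigma>\<^sub>B\<^sub>W(A)\<close> with \<open>\<sigma>\<^sub>D\<^sub>R(A)\<close>, where the point is that Browder's theorem for
  \<open>A\<close> makes a B-Weyl \<open>T = A - \<lambda>\<close> Drazin invertible (\<open>b_weyl_imp_drazin_invertible_of_browder\<close>).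
  For large \<open>d\<close> the kernel of \<open>T\<close> on \<open>R(T\<^sup>d)\<close> lies in every \<open>R(T\<^sup>k)\<close>.  If it is zero, \<open>T\<close> is bijective
  on \<open>R(T\<^sup>d)\<close>.  If not, stability of the index on \<open>R(T\<^sup>d)\<close> makes \<open>T - \<mu>\<close> Weyl for all small
  \<open>\<mu> \<noteq> 0\<close>, while stability of the index on \<open>\<Inter>\<^sub>k R(T\<^sup>k)\<close>, where \<open>T\<close> is onto with nonzero kernel, makes
  every small \<open>\<mu>\<close> an eigenvalue.  That is impossible, since a Drazin invertible \<open>T - \<mu>\<close> has no small
  nonzero eigenvalues.

  The index arguments use exact identities between extended dimensions
  (\<open>quotient_cdim_rank_nullity\<close>, \<open>quotient_cdim_exchange\<close>) and a perturbation argument based on the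
  open mapping theorem (\<open>index_stable\<close>).
\<close>

section \<open>Bases of quotient spaces\<close>

interpretation complex_vector_pair: vector_space_pair
  "scaleC :: complex \<Rightarrow> 'a \<Rightarrow> 'a::complex_normed_vector"
  "scaleC :: complex \<Rightarrow> 'b \<Rightarrow> 'b::complex_normed_vector"
  by unfold_locales

abbreviation csubspace :: "'a::complex_normed_vector set \<Rightarrow> bool" where
  "csubspace \<equiv> complex_vector.subspace"

abbreviation cspan :: "'a::complex_normed_vector set \<Rightarrow> 'a set" where
  "cspan \<equiv> complex_vector.span"

abbreviation clinear :: "('a::complex_normed_vector \<Rightarrow> 'b::complex_normed_vector) \<Rightarrow> bool" where
  "clinear \<equiv> Vector_Spaces.linear scaleC scaleC"

lemma clinear_iff:
  "clinear f \<longleftrightarrow> (\<forall>x y. f (x + y) = f x + f y) \<and> (\<forall>c x. f (c *\<^sub>C x) = c *\<^sub>C f x)"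
  unfolding Vector_Spaces.linear_iff by (simp add: complex_vector.vector_space_axioms)

lemma csubspace_iff:
  "csubspace V \<longleftrightarrow> 0 \<in> V \<and> (\<forall>x\<in>V. \<forall>y\<in>V. x + y \<in> V) \<and> (\<forall>c. \<forall>x\<in>V. c *\<^sub>C x \<in> V)"
  by (auto simp: complex_vector.subspace_def)

text \<open>
  Such a map identifies a quotient by \<open>W\<close> with a space of vectors, so that bases of quotients become
  ordinary bases and the exchange lemma applies to them.
\<close>

lemma clinear_with_kernel:
  fixes W :: "'a::complex_normed_vector set"
  assumes "csubspace W"
  shows "\<exists>p :: 'a \<Rightarrow> 'a. clinear p \<and> (\<forall>x. p x = 0 \<longleftrightarrow> x \<in> W)"
proof -
  obtain C where C: "complex_vector.independent C" "cspan C = W"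
    using complex_vector.maximal_independent_subset[of W] complex_vector.span_minimal[OF _ assms]
    by (metis antisym_conv)
  define D where "D = complex_vector.extend_basis C"
  have CD: "C \<subseteq> D" and D: "complex_vector.independent D" "cspan D = UNIV"
    using complex_vector.extend_basis_superset complex_vector.independent_extend_basis
      complex_vector.span_extend_basis C(1) unfolding D_def by blast+
  obtain p :: "'a \<Rightarrow> 'a" where p: "clinear p" "\<forall>x\<in>D. p x = (if x \<in> C then 0 else x)"
    using complex_vector_pair.linear_independent_extend[OF D(1), of "\<lambda>x. if x \<in> C then 0 else x"]
    by auto
  have on_C: "p x = 0" if "x \<in> cspan C" for x
    by (rule complex_vector_pair.linear_eq_0_on_span[OF p(1) _ that]) (use p(2) CD in auto)
  have on_D: "p x = x" if "x \<in> cspan (D - C)" for x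
    by (rule complex_vector_pair.linear_eq_on[OF p(1) complex_vector.linear_ident that]) (use p(2) in auto)
  have "x \<in> W" if "p x = 0" for x
  proof -
    have "x \<in> cspan ((D - C) \<union> C)" using CD D(2) by (simp add: Un_absorb2)
    then obtain u v where uv: "x = u + v" "u \<in> cspan (D - C)" "v \<in> cspan C"
      unfolding complex_vector.span_Un by auto
    then have "p x = u" using p(1) on_C on_D by (simp add: clinear_iff)
    with that uv C(2) show ?thesis by simp
  qed
  with p(1) on_C C(2) show ?thesis by auto
qed

lemma quotient_basis_distinct_mod:
  assumes B: "quotient_basis V W B" and ab: "a \<in> B" "b \<in> B" "a - b \<in> W"
  shows "a = b"
proof (rule ccontr)
  assume "a \<noteq> b"
  define c :: "'a \<Rightarrow> complex" where "c = (\<lambda>x. if x = a then 1 else if x = b then -1 else 0)"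
  have "(\<Sum>x\<in>B. c x *\<^sub>C x) = (\<Sum>x\<in>{a,b}. c x *\<^sub>C x)"
    by (rule sum.mono_neutral_right) (use B ab in \<open>auto simp: c_def quotient_basis_def\<close>)
  also have "\<dots> = a - b" using \<open>a \<noteq> b\<close> by (simp add: c_def scaleC_one)
  finally have "(\<Sum>x\<in>B. c x *\<^sub>C x) \<in> W" using ab(3) by simp
  then have "\<forall>x\<in>B. c x = 0" using B unfolding quotient_basis_def by blast
  with ab(1) show False by (auto simp: c_def)
qed

lemma quotient_basis_imp_independent_image:
  assumes p: "clinear p" "\<And>x. p x = 0 \<longleftrightarrow> x \<in> W" and B: "quotient_basis V W B"
  shows "inj_on p B" "complex_vector.independent (p ` B)" "p ` V \<subseteq> cspan (p ` B)"
proof -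
  interpret p: Vector_Spaces.linear scaleC scaleC p by (fact p(1))
  have fin: "finite B" and indep: "\<And>c. (\<Sum>b\<in>B. c b *\<^sub>C b) \<in> W \<Longrightarrow> \<forall>b\<in>B. c b = 0"
    and span: "\<And>x. x \<in> V \<Longrightarrow> \<exists>c. x - (\<Sum>b\<in>B. c b *\<^sub>C b) \<in> W"
    using B by (auto simp: quotient_basis_def)
  have p_sum: "p (\<Sum>b\<in>B. c b *\<^sub>C b) = (\<Sum>b\<in>B. c b *\<^sub>C p b)" for c
    by (simp add: p.sum p.scale)
  show inj: "inj_on p B"
  proof (rule inj_onI)
    fix a b assume "a \<in> B" "b \<in> B" "p a = p b"
    with p(2)[of "a - b"] show "a = b" by (auto simp: p.diff intro: quotient_basis_distinct_mod[OF B])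
  qed
  show "complex_vector.independent (p ` B)"
  proof
    assume "complex_vector.dependent (p ` B)"
    then obtain u where u: "\<exists>v\<in>p ` B. u v \<noteq> 0" "(\<Sum>v\<in>p ` B. u v *\<^sub>C v) = 0"
      using complex_vector.dependent_finite[of "p ` B"] fin by auto
    have "p (\<Sum>b\<in>B. u (p b) *\<^sub>C b) = 0"
      using u(2) by (simp add: p_sum sum.reindex[OF inj])
    then have "\<forall>b\<in>B. u (p b) = 0" using indep[of "\<lambda>b. u (p b)"] p(2)[of "\<Sum>b\<in>B. u (p b) *\<^sub>C b"] by simp
    with u(1) show False by auto
  qed
  show "p ` V \<subseteq> cspan (p ` B)"
  proof clarify
    fix x assume "x \<in> V"
    then obtain c where "x - (\<Sum>b\<in>B. c b *\<^sub>C b) \<in> W" using span by blast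
    then have "p x = (\<Sum>b\<in>B. c b *\<^sub>C p b)" using p(2)[of "x - (\<Sum>b\<in>B. c b *\<^sub>C b)"] by (simp add: p.diff p_sum)
    also have "\<dots> \<in> cspan (p ` B)"
      by (intro complex_vector.span_sum complex_vector.span_scale complex_vector.span_base) auto
    finally show "p x \<in> cspan (p ` B)" .
  qed
qed

lemma quotient_basis_card_unique:
  fixes W :: "'a::complex_normed_vector set"
  assumes "csubspace W" "quotient_basis V W B" "quotient_basis V W C"
  shows "card B = card C"
proof -
  obtain p :: "'a \<Rightarrow> 'a" where p: "clinear p" "\<And>x. p x = 0 \<longleftrightarrow> x \<in> W"
    using clinear_with_kernel[OF assms(1)] by metis
  have le: "card B \<le> card C" if B: "quotient_basis V W B" and C: "quotient_basis V W C" for B C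
  proof -
    have "p ` B \<subseteq> p ` V" using B by (auto simp: quotient_basis_def)
    then have "p ` B \<subseteq> cspan (p ` C)"
      using quotient_basis_imp_independent_image(3)[OF p C] by blast
    then have "card (p ` B) \<le> card (p ` C)"
      using complex_vector.independent_span_bound[of "p ` C" "p ` B"]
        quotient_basis_imp_independent_image(2)[OF p B] C
      by (simp add: quotient_basis_def)
    then show ?thesis
      using quotient_basis_imp_independent_image(1)[OF p] B C by (simp add: card_image)
  qed
  from le[OF assms(2,3)] le[OF assms(3,2)] show ?thesis by simp
qed

text \<open>
  A finite spanning set suffices, and it need not lie in \<open>V\<close>: a basis of the image of \<open>V\<close> under a map
  with kernel \<open>W\<close> lifts to representatives in \<open>V\<close>.
\<close>

lemma quotient_basis_exists:
  fixes W :: "'a::complex_normed_vector set"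
  assumes "csubspace W" "finite S" "\<And>x. x \<in> V \<Longrightarrow> \<exists>s\<in>cspan S. x - s \<in> W"
  shows "\<exists>B. quotient_basis V W B"
proof -
  obtain p :: "'a \<Rightarrow> 'a" where p: "clinear p" "\<And>x. p x = 0 \<longleftrightarrow> x \<in> W"
    using clinear_with_kernel[OF assms(1)] by metis
  interpret p: Vector_Spaces.linear scaleC scaleC p by (fact p(1))
  have "p ` V \<subseteq> cspan (p ` S)"
  proof clarify
    fix x assume "x \<in> V"
    then obtain s where s: "s \<in> cspan S" "x - s \<in> W" using assms(3) by blast
    then have "p x = p s" using p(2)[of "x - s"] by (simp add: p.diff)
    with s(1) show "p x \<in> cspan (p ` S)" by (simp add: p.span_image)
  qed
  moreover obtain D where D: "D \<subseteq> p ` V" "complex_vector.independent D" "p ` V \<subseteq> cspan D"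
    by (rule complex_vector.basis_exists[of "p ` V"])
  ultimately have fin: "finite D"
    using complex_vector.independent_span_bound[of "p ` S" D] assms(2) by blast
  obtain B where B: "B \<subseteq> V" "inj_on p B" "p ` B = D"
    using D(1) subset_image_inj[of D p V] by auto
  have finB: "finite B" using fin B finite_imageD by blast
  have p_sum: "p (\<Sum>b\<in>B. c b *\<^sub>C b) = (\<Sum>b\<in>B. c b *\<^sub>C p b)" for c
    by (simp add: p.sum p.scale)
  have "quotient_basis V W B"
    unfolding quotient_basis_def
  proof (intro conjI ballI allI impI finB B(1))
    fix x assume "x \<in> V"
    then have "p x \<in> cspan (p ` B)" using D(3) B(3) by auto
    then obtain u where "p x = (\<Sum>v\<in>p ` B. u v *\<^sub>C v)"
      using complex_vector.span_finite[of "p ` B"] finB by auto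
    then have "p x = p (\<Sum>b\<in>B. u (p b) *\<^sub>C b)" by (simp add: p_sum sum.reindex[OF B(2)])
    then have "x - (\<Sum>b\<in>B. u (p b) *\<^sub>C b) \<in> W"
      using p(2)[of "x - (\<Sum>b\<in>B. u (p b) *\<^sub>C b)"] by (simp add: p.diff)
    then show "\<exists>c. x - (\<Sum>b\<in>B. c b *\<^sub>C b) \<in> W" by (rule exI[of _ "\<lambda>b. u (p b)"])
  next
    fix c b assume c: "(\<Sum>b\<in>B. c b *\<^sub>C b) \<in> W" and b: "b \<in> B"
    define u where "u v = c (the_inv_into B p v)" for v
    have u: "u (p a) = c a" if "a \<in> B" for a
      using that B(2) by (simp add: u_def the_inv_into_f_f)
    have "(\<Sum>v\<in>D. u v *\<^sub>C v) = (\<Sum>b\<in>B. c b *\<^sub>C p b)"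
      by (simp add: B(3)[symmetric] sum.reindex[OF B(2)] u)
    also have "\<dots> = 0" using c p(2)[of "\<Sum>b\<in>B. c b *\<^sub>C b"] by (simp add: p_sum)
    finally have "u (p b) = 0"
      using D(2) complex_vector.dependent_finite[OF fin] b B(3) by auto
    then show "c b = 0" using u b by simp
  qed
  then show ?thesis ..
qed

lemma quotient_cdim_eq_card:
  assumes "csubspace W" "quotient_basis V W B"
  shows "quotient_cdim V W = enat (card B)"
proof -
  have "{B. quotient_basis V W B} \<noteq> {}" and "\<And>C. quotient_basis V W C \<Longrightarrow> enat (card C) = enat (card B)"
    using assms quotient_basis_card_unique by auto
  then show ?thesis unfolding quotient_cdim_def
    by (metis (mono_tags, lifting) INF_eq_const mem_Collect_eq)
qed

lemma quotient_cdim_infinite_iff: "quotient_cdim V W = \<infinity> \<longleftrightarrow> \<not> (\<exists>B. quotient_basis V W B)"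
proof
  assume "quotient_cdim V W = \<infinity>"
  moreover have "quotient_cdim V W \<le> enat (card B)" if "quotient_basis V W B" for B
    unfolding quotient_cdim_def using that by (intro INF_lower) auto
  ultimately show "\<not> (\<exists>B. quotient_basis V W B)" by fastforce
qed (simp add: quotient_cdim_def top_enat_def)

lemma quotient_basis_spanning:
  assumes "quotient_basis V W B" "x \<in> V"
  shows "\<exists>s\<in>cspan B. x - s \<in> W"
proof -
  obtain c where "x - (\<Sum>b\<in>B. c b *\<^sub>C b) \<in> W" using assms by (auto simp: quotient_basis_def)
  moreover have "(\<Sum>b\<in>B. c b *\<^sub>C b) \<in> cspan B"
    by (intro complex_vector.span_sum complex_vector.span_scale complex_vector.span_base)
  ultimately show ?thesis by blast
qed

lemma quotient_basis_Un:
  assumes V: "csubspace V" "csubspace U" "csubspace W" "W \<subseteq> U" "U \<subseteq> V"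
    and B: "quotient_basis V U B" and C: "quotient_basis U W C"
  shows "B \<inter> C = {}" "quotient_basis V W (B \<union> C)"
proof -
  have fin: "finite B" "finite C" and sub: "B \<subseteq> V" "C \<subseteq> U"
    and indB: "\<And>c. (\<Sum>b\<in>B. c b *\<^sub>C b) \<in> U \<Longrightarrow> \<forall>b\<in>B. c b = 0"
    and indC: "\<And>c. (\<Sum>b\<in>C. c b *\<^sub>C b) \<in> W \<Longrightarrow> \<forall>b\<in>C. c b = 0"
    using B C by (auto simp: quotient_basis_def)
  show disj: "B \<inter> C = {}"
  proof (rule ccontr)
    assume "B \<inter> C \<noteq> {}"
    then obtain a where a: "a \<in> B" "a \<in> C" by auto
    have "(\<Sum>b\<in>B. (if b = a then 1 else 0) *\<^sub>C b) = (\<Sum>b\<in>B. if b = a then a else 0)"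
      by (rule sum.cong) (auto simp: scaleC_one)
    also have "\<dots> = a" using fin a by (simp add: sum.delta')
    also have "a \<in> U" using a sub by auto
    finally show False using indB[of "\<lambda>b. if b = a then 1 else 0"] a by auto
  qed
  have split: "(\<Sum>b\<in>B \<union> C. c b *\<^sub>C b) = (\<Sum>b\<in>B. c b *\<^sub>C b) + (\<Sum>b\<in>C. c b *\<^sub>C b)" for c
    by (rule sum.union_disjoint[OF fin disj])
  show "quotient_basis V W (B \<union> C)"
    unfolding quotient_basis_def
  proof (intro conjI ballI allI impI)
    show "finite (B \<union> C)" "B \<union> C \<subseteq> V" using fin sub V by auto
    fix x assume "x \<in> V"
    then obtain c where c: "x - (\<Sum>b\<in>B. c b *\<^sub>C b) \<in> U" using B by (auto simp: quotient_basis_def)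
    then obtain d where d: "x - (\<Sum>b\<in>B. c b *\<^sub>C b) - (\<Sum>b\<in>C. d b *\<^sub>C b) \<in> W"
      using C by (auto simp: quotient_basis_def)
    define e where "e b = (if b \<in> B then c b else d b)" for b
    have "(\<Sum>b\<in>B. e b *\<^sub>C b) = (\<Sum>b\<in>B. c b *\<^sub>C b)" "(\<Sum>b\<in>C. e b *\<^sub>C b) = (\<Sum>b\<in>C. d b *\<^sub>C b)"
      using disj by (auto simp: e_def intro!: sum.cong)
    then have "x - (\<Sum>b\<in>B \<union> C. e b *\<^sub>C b) \<in> W" using d by (simp add: split diff_diff_eq)
    then show "\<exists>c. x - (\<Sum>b\<in>B \<union> C. c b *\<^sub>C b) \<in> W" by blast
  next
    fix c b assume c: "(\<Sum>b\<in>B \<union> C. c b *\<^sub>C b) \<in> W" and b: "b \<in> B \<union> C"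
    have "(\<Sum>b\<in>C. c b *\<^sub>C b) \<in> U"
      using sub by (intro complex_vector.subspace_sum complex_vector.subspace_scale V) auto
    moreover have "(\<Sum>b\<in>B. c b *\<^sub>C b) + (\<Sum>b\<in>C. c b *\<^sub>C b) \<in> U" using c split V by auto
    ultimately have "(\<Sum>b\<in>B. c b *\<^sub>C b) \<in> U"
      using complex_vector.subspace_diff[OF V(2)] by (metis add_diff_cancel_right')
    from indB[OF this] have B0: "\<forall>b\<in>B. c b = 0" .
    then have "(\<Sum>b\<in>C. c b *\<^sub>C b) \<in> W" using c by (simp add: split)
    from indC[OF this] B0 b show "c b = 0" by auto
  qed
qed

lemma quotient_cdim_add:
  assumes V: "csubspace V" "csubspace U" "csubspace W" "W \<subseteq> U" "U \<subseteq> V"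
  shows "quotient_cdim V W = quotient_cdim V U + quotient_cdim U W"
proof (cases "\<exists>B. quotient_basis V W B")
  case True
  then obtain D where D: "quotient_basis V W D" ..
  then have fin: "finite D" by (simp add: quotient_basis_def)
  obtain B where B: "quotient_basis V U B"
    using quotient_basis_exists[OF V(2) fin] quotient_basis_spanning[OF D] V(4) by blast
  obtain C where C: "quotient_basis U W C"
    using quotient_basis_exists[OF V(3) fin] quotient_basis_spanning[OF D] V(5) by blast
  note BC = quotient_basis_Un[OF V B C]
  have "finite B" "finite C" using B C by (auto simp: quotient_basis_def)
  then show ?thesis
    using quotient_cdim_eq_card[OF V(3) BC(2)] quotient_cdim_eq_card[OF V(2) B]
      quotient_cdim_eq_card[OF V(3) C] BC(1) by (simp add: card_Un_disjoint)
next
  case False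
  then have "quotient_cdim V U = \<infinity> \<or> quotient_cdim U W = \<infinity>"
    using quotient_basis_Un(2)[OF V] by (auto simp: quotient_cdim_infinite_iff)
  with False show ?thesis by (auto simp: quotient_cdim_infinite_iff[THEN iffD2])
qed

text \<open>
  The hypotheses say that \<open>f\<close> induces an isomorphism of \<open>V / W\<close> onto \<open>V' / W'\<close>.  With \<open>f\<close> the identity
  this is the second isomorphism theorem.
\<close>

lemma quotient_cdim_image:
  assumes f: "clinear f" and sub: "csubspace V" "csubspace W'" "csubspace V'" "W' \<subseteq> V'"
    and VV': "f ` V \<subseteq> V'" "\<And>y. y \<in> V' \<Longrightarrow> \<exists>x\<in>V. y - f x \<in> W'"
    and W: "W = {x \<in> V. f x \<in> W'}"
  shows "quotient_cdim V W = quotient_cdim V' W'"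
proof -
  interpret f: Vector_Spaces.linear scaleC scaleC f by (fact f)
  have subW: "csubspace W"
    using sub(1,2) unfolding W by (auto simp: csubspace_iff f.add f.scale f.zero)
  have f_sum: "f (\<Sum>b\<in>B. c b *\<^sub>C b) = (\<Sum>b\<in>B. c b *\<^sub>C f b)" for B c
    by (simp add: f.sum f.scale)
  show ?thesis
  proof (cases "\<exists>B. quotient_basis V W B")
    case True
    then obtain B where B: "quotient_basis V W B" ..
    then have fin: "finite B" and BV: "B \<subseteq> V"
      and indB: "\<And>c. (\<Sum>b\<in>B. c b *\<^sub>C b) \<in> W \<Longrightarrow> \<forall>b\<in>B. c b = 0"
      by (auto simp: quotient_basis_def)
    have sumV: "(\<Sum>b\<in>B. c b *\<^sub>C b) \<in> V" for c
      using BV by (intro complex_vector.subspace_sum complex_vector.subspace_scale sub) auto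
    have inj: "inj_on f B"
    proof (rule inj_onI)
      fix a b assume ab: "a \<in> B" "b \<in> B" "f a = f b"
      then have "a - b \<in> W"
        using BV complex_vector.subspace_diff[OF sub(1)] complex_vector.subspace_0[OF sub(2)]
        by (auto simp: W f.diff)
      with ab show "a = b" by (auto intro: quotient_basis_distinct_mod[OF B])
    qed
    have "quotient_basis V' W' (f ` B)"
      unfolding quotient_basis_def
    proof (intro conjI ballI allI impI)
      show "finite (f ` B)" "f ` B \<subseteq> V'" using fin BV VV' by auto
      fix y assume "y \<in> V'"
      then obtain x where x: "x \<in> V" "y - f x \<in> W'" using VV' by blast
      then obtain c where c: "x - (\<Sum>b\<in>B. c b *\<^sub>C b) \<in> W"
        using B by (auto simp: quotient_basis_def)
      then have "f (x - (\<Sum>b\<in>B. c b *\<^sub>C b)) \<in> W'" by (simp add: W)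
      then have "f x - (\<Sum>b\<in>B. c b *\<^sub>C f b) \<in> W'" by (simp add: f.diff f_sum)
      from complex_vector.subspace_add[OF sub(2) x(2) this]
      have "y - (\<Sum>b\<in>B. c b *\<^sub>C f b) \<in> W'" by simp
      moreover have "(\<Sum>b\<in>f ` B. c (the_inv_into B f b) *\<^sub>C b) = (\<Sum>b\<in>B. c b *\<^sub>C f b)"
        by (simp add: sum.reindex[OF inj] the_inv_into_f_f[OF inj])
      ultimately have "y - (\<Sum>b\<in>f ` B. c (the_inv_into B f b) *\<^sub>C b) \<in> W'" by simp
      then show "\<exists>c. y - (\<Sum>b\<in>f ` B. c b *\<^sub>C b) \<in> W'"
        by (rule exI[of _ "\<lambda>b. c (the_inv_into B f b)"])
    next
      fix c b assume c: "(\<Sum>b\<in>f ` B. c b *\<^sub>C b) \<in> W'" and b: "b \<in> f ` B"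
      then have "f (\<Sum>b\<in>B. c (f b) *\<^sub>C b) \<in> W'" by (simp add: sum.reindex[OF inj] f_sum)
      then have "(\<Sum>b\<in>B. c (f b) *\<^sub>C b) \<in> W" using sumV by (simp add: W)
      from indB[OF this] b show "c b = 0" by auto
    qed
    then show ?thesis
      using quotient_cdim_eq_card[OF subW B] quotient_cdim_eq_card[OF sub(2)] card_image[OF inj] by metis
  next
    case False
    have "\<not> (\<exists>B. quotient_basis V' W' B)"
    proof
      assume "\<exists>B. quotient_basis V' W' B"
      then obtain B where B: "quotient_basis V' W' B" ..
      then have fin: "finite B" and BV: "B \<subseteq> V'" by (auto simp: quotient_basis_def)
      obtain g where g: "\<And>y. y \<in> V' \<Longrightarrow> g y \<in> V \<and> y - f (g y) \<in> W'" using VV'(2) by metis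
      have "\<exists>s\<in>cspan (g ` B). x - s \<in> W" if x: "x \<in> V" for x
      proof -
        obtain c where c: "f x - (\<Sum>b\<in>B. c b *\<^sub>C b) \<in> W'"
          using B VV'(1) x unfolding quotient_basis_def by blast
        have "(\<Sum>b\<in>B. c b *\<^sub>C (b - f (g b))) \<in> W'"
          using g BV by (intro complex_vector.subspace_sum complex_vector.subspace_scale sub) auto
        from complex_vector.subspace_add[OF sub(2) c this]
        have "f x - (\<Sum>b\<in>B. c b *\<^sub>C f (g b)) \<in> W'" by (simp add: scaleC_diff_right sum_subtractf)
        then have "f (x - (\<Sum>b\<in>B. c b *\<^sub>C g b)) \<in> W'" by (simp add: f.diff f.sum f.scale)
        moreover have "(\<Sum>b\<in>B. c b *\<^sub>C g b) \<in> V"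
          using g BV by (intro complex_vector.subspace_sum complex_vector.subspace_scale sub) auto
        ultimately have "x - (\<Sum>b\<in>B. c b *\<^sub>C g b) \<in> W"
          using x complex_vector.subspace_diff[OF sub(1)] by (simp add: W)
        moreover have "(\<Sum>b\<in>B. c b *\<^sub>C g b) \<in> cspan (g ` B)"
          by (intro complex_vector.span_sum complex_vector.span_scale complex_vector.span_base) auto
        ultimately show ?thesis by blast
      qed
      from quotient_basis_exists[OF subW _ this] fin False show False by auto
    qed
    with False show ?thesis by (simp add: quotient_cdim_infinite_iff[THEN iffD2])
  qed
qed

lemma cdim_eq_quotient_cdim:
  assumes "csubspace V"
  shows "cdim V = quotient_cdim V {0}"
proof -
  have "finite B \<and> complex_vector.independent B \<and> cspan B = V \<longleftrightarrow> quotient_basis V {0} B" for B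
  proof (cases "finite B \<and> B \<subseteq> V")
    case True
    then have "cspan B \<subseteq> V" using complex_vector.span_minimal[OF _ assms] by blast
    moreover have "V \<subseteq> cspan B \<longleftrightarrow> (\<forall>x\<in>V. \<exists>c. x - (\<Sum>b\<in>B. c b *\<^sub>C b) \<in> {0})"
      using complex_vector.span_finite[of B] True by auto
    moreover have "complex_vector.independent B \<longleftrightarrow>
        (\<forall>c. (\<Sum>b\<in>B. c b *\<^sub>C b) \<in> {0} \<longrightarrow> (\<forall>b\<in>B. c b = 0))"
      using complex_vector.dependent_finite[of B] True by auto
    ultimately show ?thesis using True unfolding quotient_basis_def by blast
  next
    case False
    then show ?thesis using complex_vector.span_superset by (auto simp: quotient_basis_def)
  qed
  then show ?thesis by (simp add: cdim_def quotient_cdim_def)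
qed

lemma quotient_cdim_eq_0_iff:
  assumes "csubspace W"
  shows "quotient_cdim V W = 0 \<longleftrightarrow> V \<subseteq> W"
proof
  assume q: "quotient_cdim V W = 0"
  then obtain B where B: "quotient_basis V W B" by (metis quotient_cdim_infinite_iff i0_ne_infinity)
  then have "B = {}"
    using q quotient_cdim_eq_card[OF assms B] by (auto simp: zero_enat_def quotient_basis_def)
  with B show "V \<subseteq> W" by (auto simp: quotient_basis_def)
next
  assume "V \<subseteq> W"
  then have B: "quotient_basis V W {}" by (auto simp: quotient_basis_def)
  from quotient_cdim_eq_card[OF assms B] show "quotient_cdim V W = 0" by (simp add: zero_enat_def)
qed

section \<open>Functionals that separate points\<close>

definition sublinear :: "('a::real_vector \<Rightarrow> real) \<Rightarrow> bool" where
  "sublinear q \<longleftrightarrow> (\<forall>x y. q (x + y) \<le> q x + q y) \<and> (\<forall>t\<ge>0. \<forall>x. q (t *\<^sub>R x) \<le> t * q x)"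

lemma sublinear_add: "sublinear q \<Longrightarrow> q (x + y) \<le> q x + q y"
  and sublinear_scale: "sublinear q \<Longrightarrow> 0 \<le> t \<Longrightarrow> q (t *\<^sub>R x) \<le> t * q x"
  by (auto simp: sublinear_def)

lemma sublinear_ge:
  assumes "sublinear q" shows "- q (- x) \<le> q x"
proof -
  have "q 0 \<le> 2 * q 0" using sublinear_add[OF assms, of 0 0] by simp
  moreover have "q 0 \<le> q x + q (- x)" using sublinear_add[OF assms, of x "- x"] by simp
  ultimately show ?thesis by simp
qed

lemma sublinear_scale_eq:
  assumes q: "sublinear q" and t: "0 \<le> t"
  shows "q (t *\<^sub>R x) = t * q x"
proof (cases "t = 0")
  case True
  then show ?thesis
    using sublinear_scale[OF q t, of x] sublinear_add[OF q, of 0 0] by simp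
next
  case False
  then have "q x \<le> q (t *\<^sub>R x) / t"
    using sublinear_scale[OF q, of "1 / t" "t *\<^sub>R x"] t by simp
  then show ?thesis
    using sublinear_scale[OF q t, of x] False t by (simp add: le_divide_eq mult.commute)
qed

text \<open>
  The infimum of \<open>q (x + t y) - t q y\<close> over \<open>t \<ge> 0\<close> is again sublinear.  For a minimal \<open>q\<close> it must equal
  \<open>q\<close>, and then the case \<open>t = 1\<close> is additivity.  Applied to a norm, it yields a bound that is tight
  at \<open>- y\<close>.
\<close>

lemma sublinear_smaller:
  fixes q :: "'a::real_vector \<Rightarrow> real"
  assumes q: "sublinear q"
  shows "\<exists>r. sublinear r \<and> (\<forall>x. r x \<le> q x) \<and> (\<forall>x. r x \<le> q (x + y) - q y)"
proof -
  define S where "S x = (\<lambda>t. q (x + t *\<^sub>R y) - t * q y) ` {0..}" for x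
  define r where "r x = Inf (S x)" for x
  have lower: "- q (- x) \<le> q (x + t *\<^sub>R y) - t * q y" if "0 \<le> t" for x t
    using sublinear_add[OF q, of "x + t *\<^sub>R y" "- x"] sublinear_scale_eq[OF q that, of y]
    by simp
  have bdd: "bdd_below (S x)" for x
    using lower by (auto simp: S_def intro!: bdd_belowI)
  have r_le: "r x \<le> q (x + t *\<^sub>R y) - t * q y" if "0 \<le> t" for x t
    unfolding r_def using that by (intro cInf_lower bdd) (auto simp: S_def)
  have r_greatest: "b \<le> r x" if "\<And>t. 0 \<le> t \<Longrightarrow> b \<le> q (x + t *\<^sub>R y) - t * q y" for b x
    unfolding r_def using that by (intro cInf_greatest) (auto simp: S_def)
  have "sublinear r"
    unfolding sublinear_def
  proof (intro conjI allI impI)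
    fix x x'
    have "r (x + x') - (q (x + t *\<^sub>R y) - t * q y) \<le> q (x' + s *\<^sub>R y) - s * q y"
      if "0 \<le> t" "0 \<le> s" for s t
      using r_le[of "t + s" "x + x'"] sublinear_add[OF q, of "x + t *\<^sub>R y" "x' + s *\<^sub>R y"] that
      by (simp add: algebra_simps)
    then have bound: "r (x + x') - (q (x + t *\<^sub>R y) - t * q y) \<le> r x'" if "0 \<le> t" for t
      using that by (intro r_greatest) auto
    then have "r (x + x') - r x' \<le> q (x + t *\<^sub>R y) - t * q y" if "0 \<le> t" for t
      using bound[OF that] by linarith
    from r_greatest[OF this] show "r (x + x') \<le> r x + r x'" by simp
  next
    fix t :: real and x assume t: "0 \<le> t"
    show "r (t *\<^sub>R x) \<le> t * r x"
    proof (cases "t = 0")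
      case True
      then show ?thesis using r_le[of 0 0] sublinear_scale[OF q, of 0 0] by simp
    next
      case False
      have "r (t *\<^sub>R x) / t \<le> q (x + s *\<^sub>R y) - s * q y" if "0 \<le> s" for s
      proof -
        have "r (t *\<^sub>R x) \<le> q (t *\<^sub>R (x + s *\<^sub>R y)) - (t * s) * q y"
          using r_le[of "t * s" "t *\<^sub>R x"] t that by (simp add: algebra_simps)
        also have "\<dots> \<le> t * (q (x + s *\<^sub>R y) - s * q y)"
          using sublinear_scale[OF q t, of "x + s *\<^sub>R y"] by (simp add: algebra_simps)
        finally show ?thesis using t False by (simp add: divide_le_eq mult.commute)
      qed
      from r_greatest[OF this] show ?thesis using t False by (simp add: divide_le_eq mult.commute)
    qed
  qed
  moreover have "r x \<le> q x" for x using r_le[of 0 x] by simp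
  moreover have "r x \<le> q (x + y) - q y" for x using r_le[of 1 x] by simp
  ultimately show ?thesis by blast
qed

text \<open>
  By Zorn's lemma there is a minimal sublinear functional below \<open>p\<close>, and it is linear by the previous
  lemma.  Working with functionals on the whole space avoids partial domains.
\<close>

lemma sublinear_dominates_linear:
  fixes p :: "'a::real_vector \<Rightarrow> real"
  assumes p: "sublinear p"
  shows "\<exists>f. linear f \<and> (\<forall>x. f x \<le> p x)"
proof -
  define A where "A = {q. sublinear q \<and> (\<forall>x. q x \<le> p x)}"
  let ?P = "\<lambda>q r :: 'a \<Rightarrow> real. r \<le> q"
  have "\<exists>m\<in>A. \<forall>q\<in>A. q \<le> m \<longrightarrow> q = m"
  proof (rule predicate_Zorn)
    show "partial_order_on A (relation_of ?P A)"
      by (rule partial_order_on_relation_ofI) auto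
  next
    fix C assume C: "C \<in> Chains (relation_of ?P A)"
    then have CA: "q \<in> A" if "q \<in> C" for q using that unfolding Chains_def relation_of_def by auto
    have chain: "q \<le> r \<or> r \<le> q" if "q \<in> C" "r \<in> C" for q r
      using C that unfolding Chains_def relation_of_def by auto
    show "\<exists>u\<in>A. \<forall>q\<in>C. u \<le> q"
    proof (cases "C = {}")
      case True
      then show ?thesis using p by (auto simp: A_def)
    next
      case False
      define u where "u x = (INF q\<in>C. q x)" for x
      have "- p (- x) \<le> q x" if "q \<in> C" for q x
      proof -
        have "sublinear q" "q (- x) \<le> p (- x)" using CA[OF that] by (auto simp: A_def)
        then show ?thesis using sublinear_ge[of q x] by simp
      qed
      then have bdd: "bdd_below ((\<lambda>q. q x) ` C)" for x by (auto intro!: bdd_belowI)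
      have u_le: "u x \<le> q x" if "q \<in> C" for q x
        unfolding u_def by (rule cINF_lower[OF bdd that])
      have "sublinear u"
        unfolding sublinear_def
      proof (intro conjI allI impI)
        fix x y
        have "u (x + y) - q x \<le> r y" if qr: "q \<in> C" "r \<in> C" for q r
        proof -
          obtain m where m: "m \<in> C" "m \<le> q" "m \<le> r" using chain[OF qr] qr by blast
          have "u (x + y) \<le> m (x + y)" by (rule u_le[OF m(1)])
          also have "\<dots> \<le> m x + m y" using CA[OF m(1)] by (simp add: A_def sublinear_add)
          also have "\<dots> \<le> q x + r y" using m by (auto simp: le_fun_def intro: add_mono)
          finally show ?thesis by simp
        qed
        then have "u (x + y) - q x \<le> u y" if "q \<in> C" for q
          unfolding u_def[of y] using that False by (intro cINF_greatest) auto
        then have "u (x + y) - u y \<le> q x" if "q \<in> C" for q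
          using that by (simp add: algebra_simps)
        then have "u (x + y) - u y \<le> u x"
          unfolding u_def[of x] using False by (intro cINF_greatest) auto
        then show "u (x + y) \<le> u x + u y" by simp
      next
        fix t :: real and x assume t: "0 \<le> t"
        have le: "u (t *\<^sub>R x) \<le> t * q x" if "q \<in> C" for q
          using u_le[OF that, of "t *\<^sub>R x"] CA[OF that] sublinear_scale[of q t x] t
          by (auto simp: A_def)
        show "u (t *\<^sub>R x) \<le> t * u x"
        proof (cases "t = 0")
          case True
          then show ?thesis using le False by auto
        next
          case nz: False
          then have "u (t *\<^sub>R x) / t \<le> q x" if "q \<in> C" for q
            using le[OF that] t by (simp add: divide_le_eq mult.commute)
          then have "u (t *\<^sub>R x) / t \<le> u x"
            unfolding u_def[of x] using False by (intro cINF_greatest) auto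
          then show ?thesis using t nz by (simp add: divide_le_eq mult.commute)
        qed
      qed
      moreover have "u x \<le> p x" for x
      proof -
        obtain q where "q \<in> C" using False by blast
        then have "q x \<le> p x" using CA[of q] by (simp add: A_def)
        with u_le[OF \<open>q \<in> C\<close>, of x] show ?thesis by simp
      qed
      ultimately show ?thesis using u_le by (auto simp: A_def le_fun_def)
    qed
  qed
  then obtain m where m: "sublinear m" "\<And>x. m x \<le> p x"
    and min: "\<And>q. q \<in> A \<Longrightarrow> q \<le> m \<Longrightarrow> q = m"
    unfolding A_def by blast
  have super: "m x + m y \<le> m (x + y)" for x y
  proof -
    obtain r where r: "sublinear r" "\<And>x. r x \<le> m x" "\<And>x. r x \<le> m (x + y) - m y"
      using sublinear_smaller[OF m(1), of y] by blast
    have "r \<in> A" using r(1,2) m(2) order_trans unfolding A_def by blast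
    then have "r = m" using r(2) by (intro min) (auto simp: le_fun_def)
    with r(3)[of x] show ?thesis by simp
  qed
  have add: "m (x + y) = m x + m y" for x y
    using super[of x y] sublinear_add[OF m(1), of x y] by simp
  have minus: "m (- x) = - m x" for x using add[of x "- x"] add[of 0 0] by simp
  have pos: "m (t *\<^sub>R x) = t * m x" if "0 \<le> t" for t x
    using sublinear_scale[OF m(1) that, of x] sublinear_scale[OF m(1) that, of "- x"]
    by (simp add: minus)
  have "m (t *\<^sub>R x) = t * m x" for t x
    using pos[of t x] pos[of "- t" x] by (cases "0 \<le> t") (simp_all add: minus)
  then have "linear m" using add by (intro linearI) auto
  with m(2) show ?thesis by blast
qed

lemma hahn_banach_norming:
  fixes v :: "'a::real_normed_vector"
  shows "\<exists>f. linear f \<and> (\<forall>x. \<bar>f x\<bar> \<le> norm x) \<and> f v = norm v"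
proof -
  have "sublinear (norm :: 'a \<Rightarrow> real)" by (auto simp: sublinear_def norm_triangle_ineq)
  then obtain r :: "'a \<Rightarrow> real" where r: "sublinear r" "\<And>x. r x \<le> norm x" "\<And>x. r x \<le> norm (x + v) - norm v"
    using sublinear_smaller by blast
  then obtain f where f: "linear f" "\<And>x. f x \<le> r x" using sublinear_dominates_linear by blast
  have minus: "f (- x) = - f x" for x using f(1) by (rule linear_neg)
  have le: "f x \<le> norm x" for x using f(2)[of x] r(2)[of x] by simp
  have "\<bar>f x\<bar> \<le> norm x" for x using le[of x] le[of "- x"] by (simp add: minus)
  moreover have "f v = norm v" using le[of v] f(2)[of "- v"] r(3)[of "- v"] by (simp add: minus)
  ultimately show ?thesis using f(1) by blast
qed

text \<open>
  The predicate \<open>bounded_clinear\<close> speaks of maps into a type of its class of complex spaces; the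
  scalar multiplication of the codomain is here the product of complex numbers.
\<close>

definition cfunctional :: "('a::complex_normed_vector \<Rightarrow> complex) \<Rightarrow> bool" where
  "cfunctional \<phi> \<longleftrightarrow> bounded_linear \<phi> \<and> (\<forall>c x. \<phi> (c *\<^sub>C x) = c * \<phi> x)"

lemma functional_separates:
  fixes v :: "'a::complex_normed_vector"
  assumes "v \<noteq> 0"
  shows "\<exists>\<phi>. cfunctional \<phi> \<and> \<phi> v = 1"
proof -
  obtain f where f: "linear f" "\<And>x. \<bar>f x\<bar> \<le> norm x" "f v = norm v"
    using hahn_banach_norming[of v] by blast
  interpret f: linear f by (fact f(1))
  \<comment> \<open>The complex functional whose real part is \<open>f\<close> is \<open>f x - \<i> f (\<i> x)\<close>.\<close>
  define \<psi> where "\<psi> x = Complex (f x) (- f (\<i> *\<^sub>C x))" for x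
  have scale: "f (c *\<^sub>C x) = Re c * f x + Im c * f (\<i> *\<^sub>C x)" for c x
  proof -
    have "c *\<^sub>C x = Re c *\<^sub>R x + Im c *\<^sub>R (\<i> *\<^sub>C x)"
      by (simp add: scaleR_scaleC scaleC_scaleC flip: scaleC_add_left)
        (simp add: complex_eq[symmetric] mult.commute)
    then show ?thesis by (simp add: f.add f.scale)
  qed
  have clin: "\<psi> (c *\<^sub>C x) = c * \<psi> x" for c x
    by (simp add: \<psi>_def complex_eq_iff scaleC_scaleC scale[of c x] scale[of "\<i> * c" x])
  have "bounded_linear \<psi>"
  proof (rule bounded_linear_intro)
    show "\<psi> (x + y) = \<psi> x + \<psi> y" for x y
      by (simp add: \<psi>_def complex_eq_iff scaleC_add_right f.add)
    show "\<psi> (r *\<^sub>R x) = r *\<^sub>R \<psi> x" for r x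
      by (simp add: scaleR_scaleC clin scaleR_conv_of_real)
    have "cmod (\<psi> x) \<le> \<bar>f x\<bar> + \<bar>f (\<i> *\<^sub>C x)\<bar>" for x
      using cmod_le[of "\<psi> x"] by (simp add: \<psi>_def)
    also have "\<bar>f x\<bar> + \<bar>f (\<i> *\<^sub>C x)\<bar> \<le> norm x * 2" for x
      using f(2)[of x] f(2)[of "\<i> *\<^sub>C x"] by (simp add: norm_scaleC)
    finally show "norm (\<psi> x) \<le> norm x * 2" for x .
  qed
  moreover have nz: "\<psi> v \<noteq> 0" using assms f(3) by (simp add: \<psi>_def complex_eq_iff)
  ultimately have "cfunctional (\<lambda>x. \<psi> x / \<psi> v)" "\<psi> v / \<psi> v = 1"
    by (auto simp: cfunctional_def clin bounded_linear_divide bounded_linear_compose[OF bounded_linear_divide])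
  then show ?thesis by (intro exI[of _ "\<lambda>x. \<psi> x / \<psi> v"]) simp
qed

section \<open>The open mapping theorem\<close>

text \<open>
  The theorem is stated for closed subspaces of a Banach space because it is applied
  to products of two closed subspaces.  By Baire's theorem, images of balls are
  somewhere dense in the range; approximate preimages with error halved at each step then sum to an
  exact preimage.
\<close>

lemma open_mapping:
  fixes f :: "'a::banach \<Rightarrow> 'b::banach"
  assumes f: "bounded_linear f" and D: "subspace D" "closed D" and M: "closed (f ` D)"
  shows "\<exists>C>0. \<forall>y\<in>f ` D. \<exists>x\<in>D. f x = y \<and> norm x \<le> C * norm y"
proof -
  interpret f: bounded_linear f by (fact f)
  define M where "M = f ` D"
  have subM: "subspace M" unfolding M_def by (rule linear_subspace_image[OF f.linear D(1)])
  define T where "T n = closure (f ` (D \<inter> cball 0 (real n)))" for n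
  have TM: "T n \<subseteq> M" for n
    unfolding T_def using M by (intro closure_minimal) (auto simp: M_def)
  have cover: "M \<subseteq> (\<Union>n. T n)"
  proof
    fix y assume "y \<in> M"
    then obtain x where x: "x \<in> D" "y = f x" by (auto simp: M_def)
    obtain n where "norm x \<le> real n" using real_arch_simple by blast
    with x have "y \<in> T n" unfolding T_def by (intro subsetD[OF closure_subset]) auto
    then show "y \<in> (\<Union>n. T n)" by blast
  qed
  have "\<exists>n. top_of_set M interior_of T n \<noteq> {}"
  proof (rule ccontr)
    assume "\<not> ?thesis"
    then have empty: "top_of_set M interior_of T n = {}" for n by simp
    have "top_of_set M interior_of \<Union>(range T) = {}"
    proof (rule Baire_category_alt)
      show "completely_metrizable_space (top_of_set M) \<or>
          locally_compact_space (top_of_set M) \<and> regular_space (top_of_set M)"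
        using M completely_metrizable_space_closedin[OF completely_metrizable_space_euclidean, of M]
        unfolding M_def closed_closedin[symmetric] by blast
      show "countable (range T)" by simp
      fix S assume "S \<in> range T"
      then show "closedin (top_of_set M) S \<and> top_of_set M interior_of S = {}"
        using empty TM by (auto simp: T_def closed_subset)
    qed
    moreover have "openin (top_of_set M) M" by simp
    ultimately have "M = {}" using cover unfolding interior_of_eq_empty by blast
    then show False using subspace_0[OF subM] by simp
  qed
  then obtain n where "top_of_set M interior_of T n \<noteq> {}" ..
  then obtain U y0 where U: "openin (top_of_set M) U" "U \<subseteq> T n" "y0 \<in> U"
    by (auto simp: interior_of_def)
  then obtain r where r: "r > 0" "ball y0 r \<inter> M \<subseteq> U" and y0: "y0 \<in> M"
    using openin_contains_ball[of M U] by blast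
  have approx_ball: "\<exists>x\<in>D. norm x \<le> 2 * real n \<and> norm (f x - y) < e"
    if y: "y \<in> M" "norm y < r" and e: "e > 0" for y e
  proof -
    have "dist y0 (y0 + y) < r" using y(2) by (simp add: dist_norm)
    then have "y0 + y \<in> T n"
      using r(2) U(2) subspace_add[OF subM y0 y(1)] by auto
    then obtain x1 where x1: "x1 \<in> D" "norm x1 \<le> real n" "norm (f x1 - (y0 + y)) < e / 2"
      using half_gt_zero[OF e] unfolding T_def closure_approachable by (fastforce simp: dist_norm)
    have "y0 \<in> T n" using U by blast
    then obtain x2 where x2: "x2 \<in> D" "norm x2 \<le> real n" "norm (f x2 - y0) < e / 2"
      using half_gt_zero[OF e] unfolding T_def closure_approachable by (fastforce simp: dist_norm)
    have "norm (f (x1 - x2) - y) = norm ((f x1 - (y0 + y)) - (f x2 - y0))"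
      by (simp add: f.diff algebra_simps)
    also have "\<dots> < e" using norm_triangle_ineq4[of "f x1 - (y0 + y)" "f x2 - y0"] x1 x2 by linarith
    finally have "norm (f (x1 - x2) - y) < e" .
    moreover have "norm (x1 - x2) \<le> 2 * real n" using norm_triangle_ineq4[of x1 x2] x1 x2 by linarith
    ultimately show ?thesis using subspace_diff[OF D(1) x1(1) x2(1)] by blast
  qed
  \<comment> \<open>A vector is scaled to norm \<open>r / 2\<close>, where preimages have norm at most \<open>2 n\<close>; the summand \<open>1\<close>
    keeps \<open>K\<close> positive.\<close>
  define K where "K = 4 * (real n + 1) / r"
  have K: "K > 0" using r by (simp add: K_def)
  have approx: "\<exists>x\<in>D. norm x \<le> K * norm y \<and> norm (y - f x) \<le> norm y / 2" if y: "y \<in> M" for y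
  proof (cases "y = 0")
    case True
    then show ?thesis using subspace_0[OF D(1)] by (intro bexI[of _ 0]) (auto simp: f.zero)
  next
    case False
    define s where "s = r / (2 * norm y)"
    have s: "s > 0" using r False by (simp add: s_def)
    have "norm (s *\<^sub>R y) < r" using r False by (simp add: s_def)
    moreover have "s *\<^sub>R y \<in> M" using y subM by (simp add: subspace_scale)
    ultimately obtain x where x: "x \<in> D" "norm x \<le> 2 * real n" "norm (f x - s *\<^sub>R y) < r / 4"
      using approx_ball[of "s *\<^sub>R y" "r / 4"] r by auto
    define x' where "x' = (1 / s) *\<^sub>R x"
    have "x' \<in> D" using x D by (simp add: x'_def subspace_scale)
    moreover have "norm x' \<le> K * norm y"
    proof -
      have "norm x' = norm x * (2 * norm y / r)" using s r by (simp add: x'_def s_def)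
      also have "\<dots> \<le> (2 * (real n + 1)) * (2 * norm y / r)"
        using x r by (intro mult_right_mono) auto
      finally show ?thesis by (simp add: K_def algebra_simps add_divide_distrib)
    qed
    moreover have "norm (y - f x') \<le> norm y / 2"
    proof -
      have "y - f x' = (1 / s) *\<^sub>R (s *\<^sub>R y - f x)"
        using s by (simp add: x'_def f.scale scaleR_diff_right)
      then have "norm (y - f x') = norm (f x - s *\<^sub>R y) / s" using s by (simp add: norm_minus_commute)
      also have "\<dots> \<le> (r / 4) / s" using x s by (intro divide_right_mono) auto
      also have "\<dots> = norm y / 2" using r by (simp add: s_def)
      finally show ?thesis .
    qed
    ultimately show ?thesis by blast
  qed
  then obtain g where g: "\<And>y. y \<in> M \<Longrightarrow> g y \<in> D" "\<And>y. y \<in> M \<Longrightarrow> norm (g y) \<le> K * norm y"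
    "\<And>y. y \<in> M \<Longrightarrow> norm (y - f (g y)) \<le> norm y / 2"
    by metis
  have "\<exists>x\<in>D. f x = y \<and> norm x \<le> (2 * K) * norm y" if y: "y \<in> M" for y
  proof -
    \<comment> \<open>The remainders left after \<open>k\<close> correction steps.\<close>
    define ys where "ys k = ((\<lambda>z. z - f (g z)) ^^ k) y" for k
    have ys: "ys k \<in> M \<and> norm (ys k) \<le> norm y * (1 / 2) ^ k" for k
    proof (induction k)
      case 0
      then show ?case using y by (simp add: ys_def)
    next
      case (Suc k)
      have "f (g (ys k)) \<in> M" using g(1) Suc by (simp add: M_def)
      then have "ys (Suc k) \<in> M" using Suc subspace_diff[OF subM] by (simp add: ys_def)
      moreover have "norm (ys (Suc k)) \<le> norm (ys k) / 2" using g(3) Suc by (simp add: ys_def)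
      ultimately show ?case using Suc by simp
    qed
    define xs where "xs k = g (ys k)" for k
    have xs_D: "xs k \<in> D" for k using g(1) ys by (simp add: xs_def)
    have xs_le: "norm (xs k) \<le> K * norm y * (1 / 2) ^ k" for k
    proof -
      have "norm (xs k) \<le> K * norm (ys k)" using g(2) ys by (simp add: xs_def)
      also have "\<dots> \<le> K * (norm y * (1 / 2) ^ k)" using K ys by (intro mult_left_mono) auto
      finally show ?thesis by (simp add: mult.assoc)
    qed
    have geo: "(\<lambda>k. K * norm y * (1 / 2) ^ k) sums (K * norm y * 2)"
      using sums_mult[OF geometric_sums[of "1 / 2 :: real"], of "K * norm y"] by simp
    have sum_norm: "summable (\<lambda>k. norm (xs k))"
      by (rule summable_comparison_test'[OF sums_summable[OF geo], of 0]) (use xs_le in simp)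
    then have xs_sums: "xs sums suminf xs" by (rule summable_sums[OF summable_norm_cancel])
    have partial: "f (\<Sum>k<n. xs k) = y - ys n" for n
      by (induction n) (simp_all add: f.zero f.add xs_def ys_def)
    have "suminf xs \<in> D"
    proof (rule closed_sequentially[where f = "\<lambda>n. \<Sum>k<n. xs k", OF D(2)])
      show "(\<Sum>k<n. xs k) \<in> D" for n using xs_D by (intro subspace_sum D(1)) auto
      show "(\<lambda>n. \<Sum>k<n. xs k) \<longlonglongrightarrow> suminf xs" using xs_sums by (simp add: sums_def)
    qed
    moreover have "f (suminf xs) = y"
    proof (rule LIMSEQ_unique)
      show "(\<lambda>n. f (\<Sum>k<n. xs k)) \<longlonglongrightarrow> f (suminf xs)"
        by (rule f.tendsto) (use xs_sums in \<open>simp add: sums_def\<close>)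
      have "(\<lambda>n. norm y * (1 / 2) ^ n) \<longlonglongrightarrow> 0"
        by (intro tendsto_mult_right_zero LIMSEQ_power_zero) simp
      then have "ys \<longlonglongrightarrow> 0"
        by (rule Lim_null_comparison[rotated]) (use ys in simp)
      then show "(\<lambda>n. f (\<Sum>k<n. xs k)) \<longlonglongrightarrow> y"
        using tendsto_diff[OF tendsto_const[of y]] by (fastforce simp: partial)
    qed
    moreover have "norm (suminf xs) \<le> (2 * K) * norm y"
    proof -
      have "norm (suminf xs) \<le> (\<Sum>k. norm (xs k))" by (rule summable_norm[OF sum_norm])
      also have "\<dots> \<le> (\<Sum>k. K * norm y * (1 / 2) ^ k)"
        by (rule suminf_le[OF xs_le sum_norm sums_summable[OF geo]])
      also have "\<dots> = 2 * K * norm y" using sums_unique[OF geo] by simp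
      finally show ?thesis .
    qed
    ultimately show ?thesis by blast
  qed
  then show ?thesis using K by (intro exI[of _ "2 * K"]) (auto simp: M_def)
qed

lemma csubspace_imp_subspace: "csubspace V \<Longrightarrow> subspace V"
  by (auto simp: csubspace_iff subspace_def scaleR_scaleC)

text \<open>
  When \<open>b\<close> lies at distance \<open>d > 0\<close> from \<open>V\<close>, the coefficient of \<open>b\<close> depends continuously on the sum:
  \<open>\<bar>c\<bar> d \<le> norm (v + c b)\<close>.
\<close>

lemma closed_insert_direction:
  fixes V :: "'a::complex_normed_vector set"
  assumes V: "csubspace V" "closed V"
  shows "closed {x. \<exists>c. x - c *\<^sub>C b \<in> V}"
proof (cases "b \<in> V")
  case True
  have "x \<in> V" if "x - c *\<^sub>C b \<in> V" for x c
    using complex_vector.subspace_add[OF V(1) that complex_vector.subspace_scale[OF V(1) True, of c]]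
    by simp
  then have "{x. \<exists>c. x - c *\<^sub>C b \<in> V} = V" by (auto intro: exI[of _ 0])
  then show ?thesis using V(2) by simp
next
  case False
  define d where "d = infdist b V"
  have nonempty: "V \<noteq> {}" using complex_vector.subspace_0[OF V(1)] by blast
  have d: "d > 0" using in_closed_iff_infdist_zero[OF V(2) nonempty, of b] False infdist_nonneg[of b V] by (simp add: d_def)
  have bound: "cmod c * d \<le> norm (v + c *\<^sub>C b)" if v: "v \<in> V" for c v
  proof (cases "c = 0")
    case nz: False
    have "- (inverse c *\<^sub>C v) \<in> V"
      using v V(1) by (simp add: complex_vector.subspace_neg complex_vector.subspace_scale)
    then have "d \<le> norm (b + inverse c *\<^sub>C v)"
      unfolding d_def using infdist_le[of "- (inverse c *\<^sub>C v)" V b] by (simp add: dist_norm)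
    then have "cmod c * d \<le> norm (c *\<^sub>C (b + inverse c *\<^sub>C v))"
      unfolding norm_scaleC by (intro mult_left_mono) auto
    then show ?thesis using nz by (simp add: scaleC_add_right scaleC_scaleC scaleC_one add.commute)
  qed simp
  show ?thesis
    unfolding closed_sequential_limits
  proof (intro allI impI, elim conjE)
    fix z l assume "\<forall>n. z n \<in> {x. \<exists>c. x - c *\<^sub>C b \<in> V}" and lim: "z \<longlonglongrightarrow> l"
    then obtain c where c: "\<And>n. z n - c n *\<^sub>C b \<in> V" by (auto simp: choice_iff)
    have c_le: "cmod (c m - c n) * d \<le> norm (z m - z n)" for m n
      using bound[OF complex_vector.subspace_diff[OF V(1) c[of m] c[of n]], of "c m - c n"]
      by (simp add: complex_vector.scale_left_diff_distrib)
    have "Cauchy c"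
    proof (rule CauchyI)
      fix e :: real assume e: "e > 0"
      then obtain N where N: "\<And>m n. m \<ge> N \<Longrightarrow> n \<ge> N \<Longrightarrow> norm (z m - z n) < e * d"
        using CauchyD[OF LIMSEQ_imp_Cauchy[OF lim], of "e * d"] d by auto
      have "norm (c m - c n) < e" if "m \<ge> N" "n \<ge> N" for m n
        using c_le[of m n] N[OF that] d by (meson le_less_trans mult_less_cancel_right_pos)
      then show "\<exists>N. \<forall>m\<ge>N. \<forall>n\<ge>N. norm (c m - c n) < e" by blast
    qed
    then obtain a where a: "c \<longlonglongrightarrow> a" using Cauchy_convergent convergent_def by blast
    have "bounded_linear (\<lambda>c. c *\<^sub>C b)"
      by (rule bounded_linear_intro[of _ "norm b"])
        (simp_all add: scaleC_add_left scaleR_scaleC scaleC_scaleC norm_scaleC scaleR_conv_of_real)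
    from tendsto_diff[OF lim bounded_linear.tendsto[OF this a]]
    have "(\<lambda>n. z n - c n *\<^sub>C b) \<longlonglongrightarrow> l - a *\<^sub>C b" .
    then have "l - a *\<^sub>C b \<in> V" by (rule closed_sequentially[OF V(2), rotated]) (rule c)
    then show "l \<in> {x. \<exists>c. x - c *\<^sub>C b \<in> V}" by blast
  qed
qed

lemma closed_cspan_finite:
  fixes B :: "'a::complex_normed_vector set"
  shows "finite B \<Longrightarrow> closed (cspan B)"
proof (induction B rule: finite_induct)
  case (insert b B)
  then show ?case
    using closed_insert_direction[OF complex_vector.subspace_span]
    by (simp add: complex_vector.span_insert)
qed simp

section \<open>Kernel and cokernel dimensions on subspaces\<close>

lemma clinear_bop_apply: "clinear (bop_apply T)"
  by (simp add: clinear_iff bop_apply_scaleC linear_simps[OF bounded_linear_bop_apply])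

lemma bop_apply_simps [simp]:
  "bop_apply T 0 = 0"
  "bop_apply T (x + y) = bop_apply T x + bop_apply T y"
  "bop_apply T (x - y) = bop_apply T x - bop_apply T y"
  "bop_apply T (- x) = - bop_apply T x"
  "bop_apply T (c *\<^sub>C x) = c *\<^sub>C bop_apply T x"
  by (simp_all add: bop_apply_scaleC linear_simps[OF bounded_linear_bop_apply])

lemma bop_apply_algebra [simp]:
  "bop_apply (S * T) x = bop_apply S (bop_apply T x)"
  "bop_apply 1 x = x"
  "bop_apply 0 x = 0"
  "bop_apply (S - T) x = bop_apply S x - bop_apply T x"
  "bop_apply (c *\<^sub>C T) x = c *\<^sub>C bop_apply T x"
  by (transfer, simp)+

lemma bop_apply_shift [simp]: "bop_apply (shift T l) x = bop_apply T x - l *\<^sub>C x"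
  by (simp add: shift_def)

lemma csubspace_null_space [simp]: "csubspace (null_space T)"
  by (simp add: csubspace_iff null_space_def)

lemma csubspace_image [simp]: "csubspace V \<Longrightarrow> csubspace (bop_apply T ` V)"
  by (rule complex_vector_pair.linear_subspace_image[OF clinear_bop_apply])

lemma csubspace_0 [simp]: "csubspace {0}"
  by (simp add: csubspace_iff)

lemma csubspace_op_range [simp]: "csubspace (op_range T)"
  by (simp add: op_range_def)

lemma csubspace_Int [simp]: "csubspace V \<Longrightarrow> csubspace W \<Longrightarrow> csubspace (V \<inter> W)"
  by (simp add: csubspace_iff)

lemma alpha_on_eq_quotient_cdim: "csubspace D \<Longrightarrow> alpha_on D T = quotient_cdim (null_space T \<inter> D) {0}"
  by (simp add: alpha_on_def cdim_eq_quotient_cdim)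

lemma alpha_on_eq_0_iff: "csubspace D \<Longrightarrow> alpha_on D T = 0 \<longleftrightarrow> null_space T \<inter> D \<subseteq> {0}"
  by (simp add: alpha_on_eq_quotient_cdim quotient_cdim_eq_0_iff)

lemma beta_on_eq_0_iff: "csubspace M \<Longrightarrow> beta_on M T = 0 \<longleftrightarrow> M \<subseteq> bop_apply T ` M"
  by (simp add: beta_on_def quotient_cdim_eq_0_iff)

lemma alpha_on_subspace:
  assumes "csubspace D" "csubspace D0" "D0 \<subseteq> D"
  shows "alpha_on D T = quotient_cdim (null_space T \<inter> D) (null_space T \<inter> D0) + alpha_on D0 T"
  unfolding alpha_on_eq_quotient_cdim[OF assms(1)] alpha_on_eq_quotient_cdim[OF assms(2)]
  using assms by (intro quotient_cdim_add) (auto simp: complex_vector.subspace_0)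

lemma alpha_on_mono:
  assumes "csubspace D" "csubspace D0" "D0 \<subseteq> D"
  shows "alpha_on D0 T \<le> alpha_on D T"
  by (simp add: alpha_on_subspace[OF assms])

text \<open>
  The subspace \<open>S = D0 + (N(T) \<inter> D)\<close> between \<open>D0\<close> and \<open>D\<close> splits \<open>D / D0\<close> into the part that \<open>T\<close> maps
  isomorphically and the part that it kills.  The identity holds for infinite dimensions too, so no
  finiteness has to be tracked.
\<close>

lemma quotient_cdim_rank_nullity:
  assumes D: "csubspace D" "csubspace D0" "D0 \<subseteq> D"
  shows "quotient_cdim D D0 =
    quotient_cdim (bop_apply T ` D) (bop_apply T ` D0)
    + quotient_cdim (null_space T \<inter> D) (null_space T \<inter> D0)"
proof -
  define S where "S = {x \<in> D. bop_apply T x \<in> bop_apply T ` D0}"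
  have sub: "csubspace S"
    using csubspace_Int[OF D(1) complex_vector_pair.linear_subspace_vimage[OF clinear_bop_apply
      csubspace_image[OF D(2), of T], of T]] by (simp add: S_def vimage_def Int_def)
  have "quotient_cdim D D0 = quotient_cdim D S + quotient_cdim S D0"
    using D sub by (intro quotient_cdim_add) (auto simp: S_def)
  moreover have "quotient_cdim D S = quotient_cdim (bop_apply T ` D) (bop_apply T ` D0)"
  proof (rule quotient_cdim_image[OF clinear_bop_apply])
    fix y assume "y \<in> bop_apply T ` D"
    then obtain x where "x \<in> D" "y = bop_apply T x" by blast
    then show "\<exists>x\<in>D. y - bop_apply T x \<in> bop_apply T ` D0"
      using complex_vector.subspace_0[OF csubspace_image[OF D(2)]] by (intro bexI[of _ x]) auto
  qed (use D in \<open>auto simp: S_def\<close>)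
  moreover have "quotient_cdim (null_space T \<inter> D) (null_space T \<inter> D0) = quotient_cdim S D0"
  proof (rule quotient_cdim_image[of "\<lambda>x. x"])
    show "clinear (\<lambda>x::'a. x)" by (simp add: clinear_iff)
    show "(\<lambda>x. x) ` (null_space T \<inter> D) \<subseteq> S"
      using complex_vector.subspace_0[OF D(2)]
      by (auto simp: S_def null_space_def intro: rev_image_eqI[of 0])
    fix y assume "y \<in> S"
    then obtain z where z: "y \<in> D" "z \<in> D0" "bop_apply T y = bop_apply T z" by (auto simp: S_def)
    then have "y - z \<in> null_space T \<inter> D"
      using D complex_vector.subspace_diff[OF D(1)] by (auto simp: null_space_def)
    with z(2) show "\<exists>x\<in>null_space T \<inter> D. y - x \<in> D0" by (intro bexI[of _ "y - z"]) auto
  qed (use D sub in \<open>auto simp: S_def\<close>)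
  ultimately show ?thesis by simp
qed

text \<open>
  Fredholm of index zero for the induced operator, with the vanishing of the index stated as an
  equation of extended natural numbers instead of a difference.
\<close>

definition weyl_on :: "'a::complex_normed_vector set \<Rightarrow> 'a bop \<Rightarrow> bool" where
  "weyl_on M T \<longleftrightarrow> alpha_on M T = beta_on M T \<and> alpha_on M T < \<infinity>"

lemma weyl_on_iff: "weyl_on M T \<longleftrightarrow> fredholm_on M T \<and> index_on M T = 0"
  unfolding weyl_on_def fredholm_on_def index_on_def
  by (cases "alpha_on M T"; cases "beta_on M T") auto

lemma weyl_iff_weyl_on: "weyl T \<longleftrightarrow> weyl_on UNIV T"
  by (simp add: weyl_def weyl_on_iff)

text \<open>
  The index does not change when \<open>T\<close> is restricted from \<open>M\<close> to \<open>T(M)\<close>; written without subtraction this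
  holds even for infinite dimensions.
\<close>

lemma alpha_beta_on_image:
  assumes M: "csubspace M" "bop_apply T ` M \<subseteq> M"
  shows "alpha_on M T + beta_on (bop_apply T ` M) T = beta_on M T + alpha_on (bop_apply T ` M) T"
  using quotient_cdim_rank_nullity[OF M(1) csubspace_image[OF M(1)] M(2)]
    alpha_on_subspace[OF M(1) csubspace_image[OF M(1)] M(2)]
  by (simp add: beta_on_def ac_simps)

lemma weyl_on_image_iff:
  assumes M: "csubspace M" "bop_apply T ` M \<subseteq> M" and fin: "alpha_on M T < \<infinity>"
  shows "weyl_on (bop_apply T ` M) T \<longleftrightarrow> weyl_on M T"
proof -
  have "alpha_on (bop_apply T ` M) T \<le> alpha_on M T"
    using M by (intro alpha_on_mono) auto
  then show ?thesis
    using fin alpha_beta_on_image[OF M]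
    by (cases "alpha_on M T"; cases "alpha_on (bop_apply T ` M) T"; cases "beta_on M T";
        cases "beta_on (bop_apply T ` M) T") (auto simp: weyl_on_def)
qed

lemma op_range_power_Suc: "op_range (T ^ Suc n) = bop_apply T ` op_range (T ^ n)"
  by (auto simp: op_range_def)

lemma op_range_0 [simp]: "op_range 1 = UNIV"
  by (simp add: op_range_def)

lemma power_apply_commute: "bop_apply (T ^ n) (bop_apply T x) = bop_apply T (bop_apply (T ^ n) x)"
  by (simp flip: bop_apply_algebra(1) add: power_commutes)

lemma op_range_power_invariant: "bop_apply T ` op_range (T ^ n) \<subseteq> op_range (T ^ n)"
proof clarify
  fix x assume "x \<in> op_range (T ^ n)"
  then obtain y where "x = bop_apply (T ^ n) y" by (auto simp: op_range_def)
  then show "bop_apply T x \<in> op_range (T ^ n)"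
    by (simp add: op_range_def flip: power_apply_commute)
qed

lemma op_range_power_antimono: "m \<le> n \<Longrightarrow> op_range (T ^ n) \<subseteq> op_range (T ^ m)"
proof (induction n rule: dec_induct)
  case (step n)
  have "op_range (T ^ Suc n) \<subseteq> op_range (T ^ n)"
    unfolding op_range_power_Suc by (rule op_range_power_invariant)
  with step.IH show ?case by (rule subset_trans[rotated])
qed simp

lemma weyl_on_op_range_iff:
  assumes "alpha_on (op_range (T ^ m)) T < \<infinity>" "m \<le> n"
  shows "weyl_on (op_range (T ^ n)) T \<longleftrightarrow> weyl_on (op_range (T ^ m)) T"
  using assms(2)
proof (induction n rule: dec_induct)
  case (step n)
  have "alpha_on (op_range (T ^ n)) T \<le> alpha_on (op_range (T ^ m)) T"
    using step by (intro alpha_on_mono op_range_power_antimono) auto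
  then have "alpha_on (op_range (T ^ n)) T < \<infinity>" using assms(1) by (rule le_less_trans)
  then show ?case
    using weyl_on_image_iff[OF csubspace_op_range op_range_power_invariant, of T n] step.IH
    by (simp only: op_range_power_Suc)
qed simp

text \<open>
  Since the index is the same on all \<open>R(T\<^sup>n)\<close> once it is defined, the least exponent can be replaced by
  an arbitrary one.
\<close>

lemma b_weyl_iff: "b_weyl T \<longleftrightarrow> (\<exists>n. closed (op_range (T ^ n)) \<and> weyl_on (op_range (T ^ n)) T)"
proof
  assume T: "b_weyl T"
  then have "\<exists>n. b_fredholm_at n T" by (simp add: b_weyl_def b_fredholm_def)
  then have "b_fredholm_at (LEAST n. b_fredholm_at n T) T" by (rule LeastI_ex)
  with T show "\<exists>n. closed (op_range (T ^ n)) \<and> weyl_on (op_range (T ^ n)) T"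
    by (auto simp: b_weyl_def b_fredholm_at_def b_fredholm_index_def weyl_on_iff)
next
  assume "\<exists>n. closed (op_range (T ^ n)) \<and> weyl_on (op_range (T ^ n)) T"
  then obtain n where n: "closed (op_range (T ^ n))" "weyl_on (op_range (T ^ n)) T" by blast
  define m where "m = (LEAST n. b_fredholm_at n T)"
  have n_fred: "b_fredholm_at n T" using n by (simp add: b_fredholm_at_def weyl_on_iff)
  then have m: "b_fredholm_at m T" "m \<le> n" unfolding m_def by (rule LeastI, rule Least_le)
  then have "alpha_on (op_range (T ^ m)) T < \<infinity>" by (simp add: b_fredholm_at_def fredholm_on_def)
  from weyl_on_op_range_iff[OF this m(2)] n(2) have "weyl_on (op_range (T ^ m)) T" by simp
  then show "b_weyl T"
    using n_fred by (auto simp: b_weyl_def b_fredholm_def b_fredholm_index_def weyl_on_iff m_def)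
qed

section \<open>Stability of the index\<close>

text \<open>
  The open mapping theorem for \<open>(x, b) \<mapsto> T x + b\<close> on \<open>D \<times> span B\<close>, which is onto \<open>M\<close> because \<open>B\<close> represents
  a basis of the cokernel.
\<close>

lemma finite_codim_estimate:
  fixes T :: "'a::complex_banach bop"
  assumes D: "csubspace D" "closed D" and M: "csubspace M" "closed M" "bop_apply T ` D \<subseteq> M"
    and B: "quotient_basis M (bop_apply T ` D) B"
  shows "\<exists>C>0. \<forall>z\<in>M. \<exists>x\<in>D. \<exists>b\<in>cspan B. z = bop_apply T x + b \<and> norm x \<le> C * norm z \<and> norm b \<le> C * norm z"
proof -
  have fin: "finite B" and BM: "B \<subseteq> M" using B by (auto simp: quotient_basis_def)
  define h where "h = (\<lambda>(x, b). bop_apply T x + b)"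
  define E where "E = D \<times> cspan B"
  have span: "cspan B \<subseteq> M" using BM M(1) complex_vector.span_minimal by blast
  have h: "bounded_linear h"
    unfolding h_def case_prod_unfold
    by (intro bounded_linear_add bounded_linear_snd
        bounded_linear_compose[OF bounded_linear_bop_apply bounded_linear_fst])
  have "subspace E" unfolding E_def
    by (intro subspace_Times csubspace_imp_subspace D(1) complex_vector.subspace_span)
  moreover have "closed E" unfolding E_def
    by (intro closed_Times D(2) closed_cspan_finite fin)
  moreover have hE: "h ` E = M"
  proof
    show "h ` E \<subseteq> M"
      using span M(3) complex_vector.subspace_add[OF M(1)] by (force simp: h_def E_def)
    show "M \<subseteq> h ` E"
    proof
      fix z assume "z \<in> M"
      then obtain s where s: "s \<in> cspan B" "z - s \<in> bop_apply T ` D"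
        using quotient_basis_spanning[OF B] by blast
      then obtain x where "x \<in> D" "z - s = bop_apply T x" by blast
      then have "z = h (x, s)" "(x, s) \<in> E" using s(1) by (auto simp: h_def E_def algebra_simps)
      then show "z \<in> h ` E" by blast
    qed
  qed
  ultimately obtain C where C: "C > 0" "\<And>z. z \<in> M \<Longrightarrow> \<exists>e\<in>E. h e = z \<and> norm e \<le> C * norm z"
    using open_mapping[OF h, of E] M(2) by auto
  have "\<exists>x\<in>D. \<exists>b\<in>cspan B. z = bop_apply T x + b \<and> norm x \<le> C * norm z \<and> norm b \<le> C * norm z"
    if "z \<in> M" for z
  proof -
    obtain x b where "(x, b) \<in> E" "h (x, b) = z" "norm (x, b) \<le> C * norm z"
      using C(2)[OF \<open>z \<in> M\<close>] by auto
    then show ?thesis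
      using norm_fst_le[of x b] norm_snd_le[of b x] unfolding E_def h_def by force
  qed
  with C(1) show ?thesis by blast
qed

lemma quotient_basis_cspan_Int:
  assumes B: "quotient_basis V W B" and s: "s \<in> cspan B" "s \<in> W"
  shows "s = 0"
proof -
  obtain c where c: "s = (\<Sum>b\<in>B. c b *\<^sub>C b)"
    using s(1) complex_vector.span_finite[of B] B by (auto simp: quotient_basis_def)
  then have "\<forall>b\<in>B. c b = 0" using B s(2) by (auto simp: quotient_basis_def)
  with c show ?thesis by simp
qed

text \<open>
  If \<open>z\<^sub>n \<rightarrow> l\<close> with \<open>z\<^sub>n\<close> in the range, then the component of \<open>l\<close> along the complement \<open>span B\<close> equals that
  of \<open>l - z\<^sub>n\<close>, hence tends to zero.
\<close>

lemma finite_codim_range_closed: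
  fixes T :: "'a::complex_banach bop"
  assumes D: "csubspace D" "closed D" and M: "csubspace M" "closed M" "bop_apply T ` D \<subseteq> M"
    and fin: "quotient_cdim M (bop_apply T ` D) < \<infinity>"
  shows "closed (bop_apply T ` D)"
proof -
  let ?R = "bop_apply T ` D"
  have R: "csubspace ?R" using D(1) by simp
  obtain B where B: "quotient_basis M ?R B" using fin quotient_cdim_infinite_iff by force
  obtain C where C: "C > 0" "\<And>z. z \<in> M \<Longrightarrow>
      \<exists>x\<in>D. \<exists>b\<in>cspan B. z = bop_apply T x + b \<and> norm x \<le> C * norm z \<and> norm b \<le> C * norm z"
    using finite_codim_estimate[OF D M B] by blast
  show ?thesis
    unfolding closed_sequential_limits
  proof (intro allI impI, elim conjE)
    fix z l assume z: "\<forall>n. z n \<in> ?R" and lim: "z \<longlonglongrightarrow> l"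
    have lM: "l \<in> M" by (rule closed_sequentially[OF M(2) _ lim]) (use z M(3) in blast)
    then obtain x b where xb: "x \<in> D" "b \<in> cspan B" "l = bop_apply T x + b"
      using C(2) by blast
    have le: "norm b \<le> C * norm (l - z n)" for n
    proof -
      have "l - z n \<in> M" using lM z M(3) complex_vector.subspace_diff[OF M(1)] by blast
      then obtain x' b' where xb': "x' \<in> D" "b' \<in> cspan B" "l - z n = bop_apply T x' + b'"
          "norm b' \<le> C * norm (l - z n)"
        using C(2) by blast
      have "b - b' = (bop_apply T x' + z n) - bop_apply T x"
        using xb(3) xb'(3) by (simp add: algebra_simps)
      also have "\<dots> \<in> ?R"
        using xb(1) xb'(1) z
        by (intro complex_vector.subspace_diff[OF R] complex_vector.subspace_add[OF R]) auto
      finally have "b - b' = 0"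
        using quotient_basis_cspan_Int[OF B] complex_vector.span_diff[OF xb(2) xb'(2)] by blast
      with xb'(4) show ?thesis by simp
    qed
    have "(\<lambda>n. C * norm (l - z n)) \<longlonglongrightarrow> C * norm (l - l)"
      by (intro tendsto_mult_left tendsto_norm tendsto_diff tendsto_const lim)
    then have "norm b \<le> 0" using le by (intro LIMSEQ_le_const) auto
    then show "l \<in> ?R" using xb by auto
  qed
qed

text \<open>
  When \<open>T\<close> is injective on \<open>D\<close>, the map \<open>(x, b) \<mapsto> T x + b\<close> from \<open>D \<times> span B\<close> to \<open>M\<close> is bijective with
  bounded inverse.  Replacing \<open>T\<close> by \<open>T - \<mu>\<close> keeps it bijective for small \<open>\<mu>\<close>, by the contraction
  principle, so the same \<open>B\<close> represents a basis of the perturbed cokernel.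
\<close>

lemma injective_index_stable:
  fixes T :: "'a::complex_banach bop"
  assumes D: "csubspace D" "closed D" and M: "csubspace M" "closed M" "bop_apply T ` D \<subseteq> M" "D \<subseteq> M"
    and inj: "null_space T \<inter> D \<subseteq> {0}"
    and fin: "quotient_cdim M (bop_apply T ` D) < \<infinity>"
  shows "\<exists>e>0. \<forall>\<mu>. cmod \<mu> < e \<longrightarrow> null_space (shift T \<mu>) \<inter> D \<subseteq> {0} \<and>
    quotient_cdim M (bop_apply (shift T \<mu>) ` D) = quotient_cdim M (bop_apply T ` D)"
proof -
  let ?R = "bop_apply T ` D"
  have R: "csubspace ?R" using D(1) by simp
  obtain B where B: "quotient_basis M ?R B" using fin quotient_cdim_infinite_iff by force
  obtain C where C: "C > 0" "\<And>z. z \<in> M \<Longrightarrow>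
      \<exists>x\<in>D. \<exists>b\<in>cspan B. z = bop_apply T x + b \<and> norm x \<le> C * norm z \<and> norm b \<le> C * norm z"
    using finite_codim_estimate[OF D M(1-3) B] by blast
  have unique: "x = y" if "x \<in> D" "y \<in> D" "z - bop_apply T x \<in> cspan B" "z - bop_apply T y \<in> cspan B" for x y z
  proof -
    have xy: "x - y \<in> D" using that complex_vector.subspace_diff[OF D(1)] by blast
    have "bop_apply T (x - y) \<in> cspan B"
      using complex_vector.span_diff[OF that(4,3)] by simp
    then have "bop_apply T (x - y) = 0"
      using quotient_basis_cspan_Int[OF B] xy by blast
    then have "x - y \<in> null_space T \<inter> D" using xy unfolding null_space_def by blast
    then have "x - y = 0" using inj by blast
    then show ?thesis by simp
  qed
  \<comment> \<open>\<open>G z\<close> is the component in \<open>D\<close> of the preimage of \<open>z\<close>.\<close>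
  obtain G where G: "\<And>z. z \<in> M \<Longrightarrow> G z \<in> D" "\<And>z. z \<in> M \<Longrightarrow> z - bop_apply T (G z) \<in> cspan B"
    "\<And>z. z \<in> M \<Longrightarrow> norm (G z) \<le> C * norm z"
  proof -
    have "\<forall>z\<in>M. \<exists>x\<in>D. z - bop_apply T x \<in> cspan B \<and> norm x \<le> C * norm z"
      using C(2) by (metis add_diff_cancel_left')
    then show thesis using that by metis
  qed
  have small: "x = 0" if x: "x \<in> D" "bop_apply (shift T \<mu>) x \<in> cspan B" and \<mu>: "cmod \<mu> < 1 / C" for \<mu> x
  proof -
    have \<mu>x: "\<mu> *\<^sub>C x \<in> M" using x M complex_vector.subspace_scale by blast
    have "x = G (\<mu> *\<^sub>C x)"
    proof (rule unique[of _ _ "\<mu> *\<^sub>C x"])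
      show "\<mu> *\<^sub>C x - bop_apply T x \<in> cspan B"
        using complex_vector.span_neg[OF x(2)] by simp
    qed (use x G \<mu>x in auto)
    then have "norm x \<le> C * (cmod \<mu> * norm x)" using G(3)[OF \<mu>x] by (simp add: norm_scaleC)
    also have "\<dots> = (C * cmod \<mu>) * norm x" by simp
    finally have "(1 - C * cmod \<mu>) * norm x \<le> 0" by (simp add: algebra_simps)
    moreover have "1 - C * cmod \<mu> > 0" using \<mu> C(1) by (simp add: less_divide_eq mult.commute)
    ultimately show "x = 0" by (simp add: mult_le_0_iff)
  qed
  have surj: "\<exists>x\<in>D. z - bop_apply (shift T \<mu>) x \<in> cspan B" if z: "z \<in> M" and \<mu>: "cmod \<mu> < 1 / C" for z \<mu>
  proof -
    \<comment> \<open>A fixed point \<open>x\<close> of \<open>\<Phi>\<close> solves \<open>T x + b = z + \<mu> x\<close> with some \<open>b\<close> in \<open>span B\<close>.\<close>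
    define \<Phi> where "\<Phi> x = G (z + \<mu> *\<^sub>C x)" for x
    have arg: "z + \<mu> *\<^sub>C x \<in> M" if "x \<in> D" for x
      using that z M by (meson complex_vector.subspace_add complex_vector.subspace_scale subsetD)
    have "\<exists>!x\<in>D. \<Phi> x = x"
    proof (rule Banach_fix)
      show "complete D" using D(2) complete_eq_closed by blast
      show "D \<noteq> {}" using complex_vector.subspace_0[OF D(1)] by blast
      show "0 \<le> C * cmod \<mu>" "C * cmod \<mu> < 1"
        using C(1) \<mu> by (auto simp: less_divide_eq mult.commute)
      show "\<Phi> ` D \<subseteq> D" using G(1) arg by (auto simp: \<Phi>_def)
      fix x y assume xy: "x \<in> D" "y \<in> D"
      have \<mu>xy: "\<mu> *\<^sub>C (x - y) \<in> M"
        using xy M D by (meson complex_vector.subspace_diff complex_vector.subspace_scale subsetD)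
      have "\<Phi> x - \<Phi> y = G (\<mu> *\<^sub>C (x - y))"
      proof (rule unique[of _ _ "\<mu> *\<^sub>C (x - y)"])
        show "\<Phi> x - \<Phi> y \<in> D"
          using G(1)[OF arg[OF xy(1)]] G(1)[OF arg[OF xy(2)]] complex_vector.subspace_diff[OF D(1)]
          by (simp add: \<Phi>_def)
        show "\<mu> *\<^sub>C (x - y) - bop_apply T (\<Phi> x - \<Phi> y) \<in> cspan B"
          using complex_vector.span_diff[OF G(2)[OF arg[OF xy(1)]] G(2)[OF arg[OF xy(2)]]]
          by (simp add: \<Phi>_def scaleC_diff_right algebra_simps)
      qed (use G \<mu>xy in auto)
      then have "norm (\<Phi> x - \<Phi> y) \<le> C * norm (\<mu> *\<^sub>C (x - y))" using G(3)[OF \<mu>xy] by simp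
      then show "dist (\<Phi> x) (\<Phi> y) \<le> C * cmod \<mu> * dist x y"
        by (simp add: dist_norm norm_scaleC mult.assoc)
    qed
    then obtain x where x: "x \<in> D" "\<Phi> x = x" by blast
    then show ?thesis using G(2)[OF arg[OF x(1)]] by (intro bexI[of _ x]) (simp_all add: \<Phi>_def algebra_simps)
  qed
  have "null_space (shift T \<mu>) \<inter> D \<subseteq> {0} \<and> quotient_cdim M (bop_apply (shift T \<mu>) ` D) = quotient_cdim M ?R"
    if \<mu>: "cmod \<mu> < 1 / C" for \<mu>
  proof
    show "null_space (shift T \<mu>) \<inter> D \<subseteq> {0}"
      using small[OF _ _ \<mu>] complex_vector.span_zero[of B] by (auto simp: null_space_def)
    let ?S = "bop_apply (shift T \<mu>) ` D"
    have "quotient_basis M ?S B"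
      unfolding quotient_basis_def
    proof (intro conjI ballI allI impI)
      show "finite B" "B \<subseteq> M" using B by (auto simp: quotient_basis_def)
      fix z assume "z \<in> M"
      then obtain x where x: "x \<in> D" "z - bop_apply (shift T \<mu>) x \<in> cspan B" using surj \<mu> by blast
      then obtain c where "z - bop_apply (shift T \<mu>) x = (\<Sum>b\<in>B. c b *\<^sub>C b)"
        using complex_vector.span_finite[of B] B by (auto simp: quotient_basis_def)
      then have "z - (\<Sum>b\<in>B. c b *\<^sub>C b) = bop_apply (shift T \<mu>) x" by (simp add: algebra_simps)
      then show "\<exists>c. z - (\<Sum>b\<in>B. c b *\<^sub>C b) \<in> ?S" using x(1) by blast
    next
      fix c b assume c: "(\<Sum>b\<in>B. c b *\<^sub>C b) \<in> ?S" and b: "b \<in> B"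
      then obtain x where x: "x \<in> D" "(\<Sum>b\<in>B. c b *\<^sub>C b) = bop_apply (shift T \<mu>) x" by blast
      have "bop_apply (shift T \<mu>) x \<in> cspan B"
        unfolding x(2)[symmetric]
        by (intro complex_vector.span_sum complex_vector.span_scale complex_vector.span_base)
      then have "x = 0" using small x(1) \<mu> by blast
      then have "(\<Sum>b\<in>B. c b *\<^sub>C b) \<in> ?R" using x complex_vector.subspace_0[OF R] by simp
      then show "c b = 0" using B b by (auto simp: quotient_basis_def)
    qed
    from quotient_cdim_eq_card[OF csubspace_image[OF D(1)] this]
    show "quotient_cdim M ?S = quotient_cdim M ?R"
      using quotient_cdim_eq_card[OF R B] by simp
  qed
  then show ?thesis using C(1) by (intro exI[of _ "1 / C"]) auto
qed

text \<open>
  Passing from \<open>D\<close> to a subspace of codimension \<open>c\<close> lowers the index of \<open>T : D \<rightarrow> M\<close> by \<open>c\<close>.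
\<close>

lemma quotient_cdim_exchange:
  assumes D: "csubspace D" "csubspace D0" "D0 \<subseteq> D" and M: "csubspace M" "bop_apply T ` D \<subseteq> M"
  shows "quotient_cdim D D0 + alpha_on D0 T + quotient_cdim M (bop_apply T ` D) =
    alpha_on D T + quotient_cdim M (bop_apply T ` D0)"
proof -
  have "quotient_cdim M (bop_apply T ` D0) =
      quotient_cdim M (bop_apply T ` D) + quotient_cdim (bop_apply T ` D) (bop_apply T ` D0)"
    using D M by (intro quotient_cdim_add) auto
  then show ?thesis
    using quotient_cdim_rank_nullity[OF D, of T] alpha_on_subspace[OF D, of T] by (simp add: ac_simps)
qed

text \<open>
  Induction on the dimension of the kernel: a bounded functional that does not vanish on a kernel
  vector cuts \<open>D\<close> down to a closed hyperplane with smaller kernel and the same range.  By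
  \<open>quotient_cdim_exchange\<close> the index drops by one for \<open>T\<close> and for \<open>T - \<mu>\<close> alike.  The domain has to be
  separate from the target \<open>M\<close> because it shrinks in the induction.
\<close>

lemma index_stable:
  fixes T :: "'a::complex_banach bop"
  assumes D: "csubspace D" "closed D" and M: "csubspace M" "closed M" "bop_apply T ` D \<subseteq> M" "D \<subseteq> M"
    and fin: "alpha_on D T < \<infinity>" "quotient_cdim M (bop_apply T ` D) < \<infinity>"
  shows "\<exists>e>0. \<forall>\<mu>. cmod \<mu> < e \<longrightarrow> alpha_on D (shift T \<mu>) < \<infinity> \<and>
    alpha_on D (shift T \<mu>) + quotient_cdim M (bop_apply T ` D) =
    alpha_on D T + quotient_cdim M (bop_apply (shift T \<mu>) ` D)"
proof -
  obtain a where "alpha_on D T = enat a" using fin(1) by auto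
  then show ?thesis
    using D M(3,4) fin(2)
  proof (induction a arbitrary: D)
    case 0
    then have "null_space T \<inter> D \<subseteq> {0}" by (simp add: zero_enat_def[symmetric] alpha_on_eq_0_iff)
    then obtain e where e: "e > 0" "\<And>\<mu>. cmod \<mu> < e \<Longrightarrow> null_space (shift T \<mu>) \<inter> D \<subseteq> {0} \<and>
        quotient_cdim M (bop_apply (shift T \<mu>) ` D) = quotient_cdim M (bop_apply T ` D)"
      using injective_index_stable[OF 0(2,3) M(1,2) 0(4,5) _ 0(6)] by blast
    have "alpha_on D (shift T \<mu>) = 0" if "cmod \<mu> < e" for \<mu>
      using e(2)[OF that] 0(2) by (simp add: alpha_on_eq_0_iff)
    then show ?case using e 0(1) by (intro exI[of _ e]) (auto simp: zero_enat_def[symmetric])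
  next
    case (Suc a)
    have "alpha_on D T \<noteq> 0" using Suc(2) by (simp add: zero_enat_def)
    then obtain v where v: "v \<in> D" "bop_apply T v = 0" "v \<noteq> 0"
      using Suc(3) by (auto simp: alpha_on_eq_0_iff null_space_def)
    obtain \<phi> where \<phi>: "cfunctional \<phi>" "\<phi> v = 1" using functional_separates[OF v(3)] by blast
    then have bl: "bounded_linear \<phi>" and hom: "\<And>c x. \<phi> (c *\<^sub>C x) = c * \<phi> x"
      by (auto simp: cfunctional_def)
    note \<phi>_simps = linear_simps[OF bl] hom
    define D0 where "D0 = {x \<in> D. \<phi> x = 0}"
    have D0: "csubspace D0" "D0 \<subseteq> D"
      using Suc(3) by (auto simp: D0_def csubspace_iff \<phi>_simps)
    have "closed (D \<inter> \<phi> -` {0})"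
      using Suc(4) by (intro closed_Int closed_vimage)
        (auto simp: linear_continuous_on[OF bl] continuous_on_eq_continuous_at intro!: linear_continuous_at[OF bl])
    also have "D \<inter> \<phi> -` {0} = D0" by (auto simp: D0_def)
    finally have closed: "closed D0" .
    have decomp: "x - \<phi> x *\<^sub>C v \<in> D0" if "x \<in> D" for x
      using that v(1) Suc(3) by (simp add: D0_def complex_vector.subspace_diff complex_vector.subspace_scale \<phi>_simps \<phi>(2))
    have "quotient_basis D D0 {v}"
      unfolding quotient_basis_def
    proof (intro conjI ballI allI impI)
      fix x assume "x \<in> D"
      with decomp show "\<exists>c. x - (\<Sum>b\<in>{v}. c b *\<^sub>C b) \<in> D0" by (intro exI[of _ "\<lambda>_. \<phi> x"]) simp
    qed (use v(1) in \<open>auto simp: D0_def \<phi>_simps \<phi>(2)\<close>)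
    from quotient_cdim_eq_card[OF D0(1) this] have codim1: "quotient_cdim D D0 = 1"
      by (simp add: one_enat_def)
    have same: "bop_apply T ` D0 = bop_apply T ` D"
    proof
      show "bop_apply T ` D \<subseteq> bop_apply T ` D0"
      proof clarify
        fix x assume "x \<in> D"
        from decomp[OF this] show "bop_apply T x \<in> bop_apply T ` D0"
          by (rule rev_image_eqI) (simp add: v(2))
      qed
    qed (use D0 in auto)
    have "1 + alpha_on D0 T + quotient_cdim M (bop_apply T ` D) = alpha_on D T + quotient_cdim M (bop_apply T ` D)"
      using quotient_cdim_exchange[OF Suc(3) D0 M(1) Suc(5)] codim1 same by simp
    then have a: "alpha_on D0 T = enat a"
      using Suc(2,7) by (cases "alpha_on D0 T"; cases "quotient_cdim M (bop_apply T ` D)") (auto simp: one_enat_def)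
    have "bop_apply T ` D0 \<subseteq> M" "D0 \<subseteq> M" "quotient_cdim M (bop_apply T ` D0) < \<infinity>"
      using Suc(5-7) D0 same by auto
    from Suc(1)[OF a D0(1) closed this] obtain e where e: "e > 0"
      "\<And>\<mu>. cmod \<mu> < e \<Longrightarrow> alpha_on D0 (shift T \<mu>) < \<infinity> \<and>
        alpha_on D0 (shift T \<mu>) + quotient_cdim M (bop_apply T ` D) =
        alpha_on D0 T + quotient_cdim M (bop_apply (shift T \<mu>) ` D0)"
      unfolding same by blast
    have "alpha_on D (shift T \<mu>) < \<infinity> \<and>
        alpha_on D (shift T \<mu>) + quotient_cdim M (bop_apply T ` D) =
        alpha_on D T + quotient_cdim M (bop_apply (shift T \<mu>) ` D)" if \<mu>: "cmod \<mu> < e" for \<mu>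
    proof -
      let ?S = "shift T \<mu>"
      have "bop_apply ?S ` D \<subseteq> M"
        using Suc(5,6) M(1) by (auto intro!: complex_vector.subspace_diff complex_vector.subspace_scale)
      from quotient_cdim_exchange[OF Suc(3) D0 M(1) this] codim1
      have ex: "1 + alpha_on D0 ?S + quotient_cdim M (bop_apply ?S ` D) =
          alpha_on D ?S + quotient_cdim M (bop_apply ?S ` D0)" by simp
      have "1 = quotient_cdim (bop_apply ?S ` D) (bop_apply ?S ` D0)
          + quotient_cdim (null_space ?S \<inter> D) (null_space ?S \<inter> D0)"
        using quotient_cdim_rank_nullity[OF Suc(3) D0, of ?S] codim1 by simp
      then have "quotient_cdim (null_space ?S \<inter> D) (null_space ?S \<inter> D0) \<noteq> \<infinity>"
        by (metis infinity_ne_i1 plus_enat_simps(3))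
      with alpha_on_subspace[OF Suc(3) D0, of ?S] e(2)[OF \<mu>] have "alpha_on D ?S < \<infinity>"
        by (cases "quotient_cdim (null_space ?S \<inter> D) (null_space ?S \<inter> D0)"; cases "alpha_on D0 ?S") auto
      then show ?thesis
        using ex e(2)[OF \<mu>] a Suc(2,7)
        by (cases "alpha_on D ?S"; cases "alpha_on D0 ?S"; cases "quotient_cdim M (bop_apply T ` D)";
            cases "quotient_cdim M (bop_apply ?S ` D)"; cases "quotient_cdim M (bop_apply ?S ` D0)")
          (auto simp: one_enat_def)
    qed
    then show ?case using e(1) by blast
  qed
qed

section \<open>Drazin invertibility, ascent and descent\<close>

lemma alpha_on_op_range_eq_0_iff:
  "alpha_on (op_range (T ^ n)) T = 0 \<longleftrightarrow> null_space (T ^ n) = null_space (T ^ (n + 1))"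
proof -
  have "null_space T \<inter> op_range (T ^ n) \<subseteq> {0} \<longleftrightarrow> null_space (T ^ (n + 1)) \<subseteq> null_space (T ^ n)"
    by (auto simp: null_space_def op_range_def)
  moreover have "null_space (T ^ n) \<subseteq> null_space (T ^ (n + 1))"
    by (auto simp: null_space_def)
  ultimately show ?thesis by (auto simp: alpha_on_eq_0_iff)
qed

lemma beta_on_op_range_eq_0_iff:
  "beta_on (op_range (T ^ n)) T = 0 \<longleftrightarrow> op_range (T ^ n) = op_range (T ^ (n + 1))"
  using op_range_power_invariant[of T n]
  by (auto simp: beta_on_eq_0_iff simp flip: op_range_power_Suc)

text \<open>
  On \<open>M = R(T\<^sup>n)\<close> the two conditions say that the ascent and the descent are at most \<open>n\<close>.
\<close>

definition bijective_on :: "'a::complex_normed_vector set \<Rightarrow> 'a bop \<Rightarrow> bool" where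
  "bijective_on M T \<longleftrightarrow> alpha_on M T = 0 \<and> beta_on M T = 0"

lemma bijective_on_imp_weyl_on: "bijective_on M T \<Longrightarrow> weyl_on M T"
  by (simp add: bijective_on_def weyl_on_def zero_enat_def)

lemma bijective_on_op_range_power:
  assumes "bijective_on (op_range (T ^ n)) T"
  shows "op_range (T ^ (n + k)) = op_range (T ^ n)" "null_space (T ^ (n + k)) = null_space (T ^ n)"
proof -
  have "op_range (T ^ n) = op_range (T ^ Suc n)" and N: "null_space (T ^ n) = null_space (T ^ Suc n)"
    using assms unfolding bijective_on_def alpha_on_op_range_eq_0_iff beta_on_op_range_eq_0_iff
    by (simp_all only: Suc_eq_plus1)
  then have R: "bop_apply T ` op_range (T ^ n) = op_range (T ^ n)"
    by (simp only: op_range_power_Suc)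
  show "op_range (T ^ (n + k)) = op_range (T ^ n)"
    by (induction k) (simp_all only: add_Suc_right op_range_power_Suc R add.right_neutral)
  show "null_space (T ^ (n + k)) = null_space (T ^ n)"
  proof (induction k)
    case (Suc k)
    have split: "T ^ (n + Suc k) = T ^ Suc n * T ^ k" by (metis add_Suc_shift power_add)
    have "null_space (T ^ (n + Suc k)) = {x. bop_apply (T ^ k) x \<in> null_space (T ^ Suc n)}"
      unfolding split by (simp only: null_space_def mem_Collect_eq bop_apply_algebra(1))
    also have "\<dots> = null_space (T ^ (n + k))"
      unfolding N[symmetric] by (simp add: null_space_def power_add)
    finally show ?case using Suc by simp
  qed simp
qed

text \<open>
  For a Drazin inverse \<open>S\<close> the product \<open>S T\<close> is a bounded projection onto \<open>R(T\<^sup>m)\<close>, and on that range \<open>S\<close>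
  inverts \<open>T\<close>.
\<close>

lemma drazin_invertible_imp_bijective_on:
  assumes "drazin_invertible T"
  shows "\<exists>m. closed (op_range (T ^ m)) \<and> bijective_on (op_range (T ^ m)) T"
proof -
  obtain S m where S: "T ^ m = T ^ m * S * T" "S * T * S = S" "T * S = S * T"
    using assms by (auto simp: drazin_invertible_def)
  have comm: "T ^ m * S = S * T ^ m" using power_commuting_commutes[OF S(3)] .
  have left: "T ^ m = (S * T) * T ^ m"
    using S(1) comm by (simp add: power_commutes mult.assoc)
  have "S * T = S ^ k * T ^ k * (S * T)" for k
  proof (induction k)
    case (Suc k)
    have "S ^ Suc k * T ^ Suc k * (S * T) = S ^ k * (S * T) * T ^ k * (S * T)"
      by (simp only: power_Suc2[of S] power_Suc[of T] mult.assoc)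
    also have "\<dots> = S ^ k * T ^ k * ((S * T) * (S * T))"
    proof -
      have comm: "T ^ k * (S * T) = (S * T) * T ^ k"
        by (rule power_commuting_commutes) (simp add: S(3) flip: mult.assoc)
      have "S ^ k * (S * T) * T ^ k * (S * T) = S ^ k * ((S * T) * T ^ k) * (S * T)"
        by (simp only: mult.assoc)
      then show ?thesis by (simp only: comm[symmetric]) (simp only: mult.assoc)
    qed
    also have "(S * T) * (S * T) = S * T" using S(2) by (simp add: mult.assoc[symmetric])
    finally show ?case using Suc by simp
  qed simp
  from this[of m] have right: "S * T = T ^ m * S ^ m * (S * T)"
    using power_commuting_commutes[of T "S ^ m" m] power_commuting_commutes[of S T m] S(3) by simp
  have range: "op_range (T ^ m) = {x. bop_apply (S * T) x = x}"
  proof (intro equalityI subsetI)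
    fix x assume "x \<in> op_range (T ^ m)"
    then obtain y where "x = bop_apply (T ^ m) y" by (auto simp: op_range_def)
    then have "bop_apply (S * T) x = bop_apply (S * T * T ^ m) y" by simp
    then have "bop_apply (S * T) x = x" unfolding left[symmetric] by (simp only: \<open>x = _\<close>)
    then show "x \<in> {x. bop_apply (S * T) x = x}" by simp
  next
    fix x assume "x \<in> {x. bop_apply (S * T) x = x}"
    then have "x = bop_apply (T ^ m * S ^ m * (S * T)) x" using right by simp
    then have "x = bop_apply (T ^ m) (bop_apply (S ^ m * (S * T)) x)"
      by (simp only: mult.assoc bop_apply_algebra(1))
    then show "x \<in> op_range (T ^ m)" unfolding op_range_def by blast
  qed
  have "closed {x. bop_apply (S * T) x = x}"
    by (intro closed_Collect_eq continuous_on_id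
        linear_continuous_on[OF bounded_linear_bop_apply])
  moreover have "bijective_on (op_range (T ^ m)) T"
    unfolding bijective_on_def
  proof
    show "alpha_on (op_range (T ^ m)) T = 0"
      unfolding alpha_on_eq_0_iff[OF csubspace_op_range] by (auto simp: range null_space_def)
    show "beta_on (op_range (T ^ m)) T = 0"
      unfolding beta_on_eq_0_iff[OF csubspace_op_range]
    proof
      fix x assume x: "x \<in> op_range (T ^ m)"
      then have "bop_apply T (bop_apply S x) = x"
        using S(3) by (simp add: range flip: bop_apply_algebra(1))
      moreover have "bop_apply (S * T) (bop_apply S x) = bop_apply S x"
        using S(2) by (simp flip: bop_apply_algebra(1))
      ultimately show "x \<in> bop_apply T ` op_range (T ^ m)"
        unfolding range by (metis (mono_tags, lifting) image_eqI mem_Collect_eq)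
    qed
  qed
  ultimately show ?thesis unfolding range[symmetric] by blast
qed

text \<open>
  Algebraically the space is the direct sum of \<open>N(T\<^sup>p)\<close> and \<open>R(T\<^sup>p)\<close>, and the Drazin inverse sends
  \<open>T\<^sup>p\<^sup>+\<^sup>1 x + y\<close>, with \<open>y\<close> in \<open>N(T\<^sup>p)\<close>, to \<open>T\<^sup>p x\<close>.  The open mapping theorem for \<open>(x, y) \<mapsto> T\<^sup>p\<^sup>+\<^sup>1 x + y\<close>
  makes it bounded, since its domain is closed.
\<close>

lemma bijective_on_imp_drazin_invertible:
  fixes T :: "'a::complex_banach bop"
  assumes bij: "bijective_on (op_range (T ^ p)) T"
  shows "drazin_invertible T"
proof -
  let ?q = "p + (p + 1)"
  note stable = bijective_on_op_range_power[OF bij]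
  have mult: "bop_apply (T ^ (i + j)) x = bop_apply (T ^ i) (bop_apply (T ^ j) x)" for i j x
    by (simp add: power_add)
  have T_pow: "bop_apply (T ^ i) (bop_apply T x) = bop_apply T (bop_apply (T ^ i) x)" for i x
    by (rule power_apply_commute)
  define h where "h = (\<lambda>(x, y). bop_apply (T ^ (p + 1)) x + y)"
  let ?E = "UNIV \<times> null_space (T ^ p)"
  have h: "bounded_linear h"
    unfolding h_def case_prod_unfold
    by (intro bounded_linear_add bounded_linear_snd
        bounded_linear_compose[OF bounded_linear_bop_apply bounded_linear_fst])
  have "null_space (T ^ p) = bop_apply (T ^ p) -` {0}" by (auto simp: null_space_def)
  then have "closed (null_space (T ^ p))"
    using continuous_closed_vimage[OF closed_singleton linear_continuous_at[OF bounded_linear_bop_apply]]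
    by simp
  then have E: "subspace ?E" "closed ?E"
    by (auto intro!: subspace_Times csubspace_imp_subspace closed_Times)
  have hE: "h ` ?E = UNIV"
  proof -
    have "z \<in> h ` ?E" for z
    proof -
      have "bop_apply (T ^ p) z \<in> op_range (T ^ ?q)"
        unfolding stable(1) by (simp add: op_range_def)
      then obtain x where x: "bop_apply (T ^ p) z = bop_apply (T ^ ?q) x" by (auto simp: op_range_def)
      then have "z - bop_apply (T ^ (p + 1)) x \<in> null_space (T ^ p)"
        by (simp only: null_space_def mem_Collect_eq bop_apply_simps mult[of p "p + 1"] diff_self)
      then show ?thesis
        by (intro image_eqI[of _ _ "(x, z - bop_apply (T ^ (p + 1)) x)"]) (auto simp: h_def)
    qed
    then show ?thesis by blast
  qed
  obtain C where C: "C > 0" "\<And>z. \<exists>e\<in>?E. h e = z \<and> norm e \<le> C * norm z"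
    using open_mapping[OF h E] hE by auto
  have "\<exists>x. bop_apply (T ^ p) z = bop_apply (T ^ ?q) x \<and> norm x \<le> C * norm z" for z
  proof -
    obtain x y where y: "y \<in> null_space (T ^ p)" and hz: "h (x, y) = z"
      and le: "norm (x, y) \<le> C * norm z"
      using C(2)[of z] by auto
    have "z = bop_apply (T ^ (p + 1)) x + y" using hz by (simp add: h_def)
    then have "bop_apply (T ^ p) z = bop_apply (T ^ ?q) x"
      using y by (simp only: null_space_def mem_Collect_eq bop_apply_simps mult[of p "p + 1"] add_0_right)
    moreover have "norm x \<le> C * norm z" using norm_fst_le[of x y] le by simp
    ultimately show ?thesis by blast
  qed
  then obtain g where g: "\<And>z. bop_apply (T ^ p) z = bop_apply (T ^ ?q) (g z)"
    "\<And>z. norm (g z) \<le> C * norm z"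
    by metis
  define s where "s z = bop_apply (T ^ p) (g z)" for z
  \<comment> \<open>All algebraic identities for \<open>s\<close> follow from its independence of the chosen \<open>x\<close>.\<close>
  have s_eq: "s z = bop_apply (T ^ p) x" if "bop_apply (T ^ p) z = bop_apply (T ^ ?q) x" for z x
  proof -
    have "g z - x \<in> null_space (T ^ ?q)" using that g(1)[of z] by (simp add: null_space_def)
    then have "g z - x \<in> null_space (T ^ p)" unfolding stable(2) .
    then show ?thesis by (simp add: null_space_def s_def)
  qed
  have "bounded_clinear s"
    unfolding bounded_clinear_def
  proof (intro conjI allI)
    have add: "s (x + y) = s x + s y" for x y
      using s_eq[of "x + y" "g x + g y"] g(1) by (simp add: s_def)
    show scale: "s (c *\<^sub>C x) = c *\<^sub>C s x" for c x
      using s_eq[of "c *\<^sub>C x" "c *\<^sub>C g x"] g(1) by (simp add: s_def)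
    show "bounded_linear s"
    proof (rule bounded_linear_intro[OF add])
      show "s (r *\<^sub>R x) = r *\<^sub>R s x" for r x by (simp add: scaleR_scaleC scale)
      show "norm (s x) \<le> norm x * (norm (T ^ p) * C)" for x
      proof -
        have "norm (s x) \<le> norm (T ^ p) * norm (g x)"
          unfolding s_def norm_bop.rep_eq by (rule onorm[OF bounded_linear_bop_apply])
        also have "\<dots> \<le> norm (T ^ p) * (C * norm x)" by (intro mult_left_mono g) simp
        finally show ?thesis by (simp add: ac_simps)
      qed
    qed
  qed
  then have S: "bop_apply (Bop s) = s" by (simp add: Bop_inverse)
  have Tq: "bop_apply (T ^ ?q) x = bop_apply T (bop_apply (T ^ p) (bop_apply (T ^ p) x))" for x
    by (simp add: power_add T_pow flip: mult.assoc)
  have comm: "s (bop_apply T z) = bop_apply T (s z)" for z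
  proof -
    have "s (bop_apply T z) = bop_apply (T ^ p) (bop_apply T (g z))"
      by (rule s_eq) (simp only: T_pow g(1))
    then show ?thesis by (simp add: s_def T_pow)
  qed
  have "T ^ p = T ^ p * Bop s * T"
  proof (rule bop_eqI)
    fix x
    show "bop_apply (T ^ p) x = bop_apply (T ^ p * Bop s * T) x"
      using g(1)[of x] by (simp only: bop_apply_algebra S comm T_pow) (simp only: s_def Tq)
  qed
  moreover have "Bop s * T * Bop s = Bop s"
  proof (rule bop_eqI)
    fix x
    have "s (bop_apply T (s x)) = bop_apply (T ^ p) (g x)"
      by (rule s_eq) (simp only: s_def Tq T_pow)
    then show "bop_apply (Bop s * T * Bop s) x = bop_apply (Bop s) x" by (simp add: S s_def)
  qed
  moreover have "T * Bop s = Bop s * T" by (rule bop_eqI) (simp add: S comm)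
  ultimately show ?thesis unfolding drazin_invertible_def by blast
qed

lemma drazin_invertible_iff_bijective_on:
  fixes T :: "'a::complex_banach bop"
  shows "drazin_invertible T \<longleftrightarrow> (\<exists>n. bijective_on (op_range (T ^ n)) T)"
  using drazin_invertible_imp_bijective_on bijective_on_imp_drazin_invertible by blast

lemma drazin_invertible_imp_b_weyl: "drazin_invertible T \<Longrightarrow> b_weyl T"
  unfolding b_weyl_iff using drazin_invertible_imp_bijective_on bijective_on_imp_weyl_on by blast

lemma INF_enat_eq_Least: "\<exists>n. P n \<Longrightarrow> (INF n\<in>{n. P n}. enat n) = enat (LEAST n. P n)"
  by (intro antisym INF_lower INF_greatest) (auto intro: LeastI Least_le)

lemma INF_enat_eq_infinity: "\<nexists>n. P n \<Longrightarrow> (INF n\<in>{n. P n}. enat n) = \<infinity>"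
  by (simp add: top_enat_def)

text \<open>
  When both are finite they agree: if the ranges are stable from \<open>q\<close> on, the kernel on \<open>R(T\<^sup>q)\<close> is that
  on a later range, hence zero; conversely, where the kernel is zero the cokernel is zero because the
  index is zero on later ranges and does not depend on the range.
\<close>

lemma ascent_eq_descent_iff:
  "ascent T = descent T \<and> ascent T < \<infinity> \<longleftrightarrow> (\<exists>n. bijective_on (op_range (T ^ n)) T)"
proof -
  define P where "P n \<longleftrightarrow> alpha_on (op_range (T ^ n)) T = 0" for n
  define Q where "Q n \<longleftrightarrow> beta_on (op_range (T ^ n)) T = 0" for n
  have asc: "ascent T = (INF n\<in>{n. P n}. enat n)" and dsc: "descent T = (INF n\<in>{n. Q n}. enat n)"
    by (simp_all only: ascent_def descent_def P_def Q_def alpha_on_op_range_eq_0_iff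
        beta_on_op_range_eq_0_iff)
  have bij: "bijective_on (op_range (T ^ n)) T \<longleftrightarrow> P n \<and> Q n" for n
    by (simp add: bijective_on_def P_def Q_def)
  show ?thesis
  proof
    assume eq: "ascent T = descent T \<and> ascent T < \<infinity>"
    have ex: "\<exists>n. P n" "\<exists>n. Q n"
      using eq INF_enat_eq_infinity[of P, folded asc] INF_enat_eq_infinity[of Q, folded dsc]
      by (metis order_less_irrefl)+
    then have "(LEAST n. P n) = (LEAST n. Q n)"
      using eq INF_enat_eq_Least[of P] INF_enat_eq_Least[of Q] asc dsc by simp
    then have "P (LEAST n. P n) \<and> Q (LEAST n. P n)" using LeastI_ex[OF ex(1)] LeastI_ex[OF ex(2)] by simp
    then show "\<exists>n. bijective_on (op_range (T ^ n)) T" unfolding bij by blast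
  next
    assume "\<exists>n. bijective_on (op_range (T ^ n)) T"
    then obtain N where N: "bijective_on (op_range (T ^ N)) T" ..
    then have ex: "\<exists>n. P n" "\<exists>n. Q n" by (auto simp: bij)
    define p where "p = (LEAST n. P n)"
    define q where "q = (LEAST n. Q n)"
    have p: "P p" "p \<le> N" using N unfolding p_def bij by (blast intro: LeastI Least_le)+
    have q: "Q q" "q \<le> N" using N unfolding q_def bij by (blast intro: LeastI Least_le)+
    have "op_range (T ^ q) = op_range (T ^ Suc q)"
      using q(1) unfolding Q_def beta_on_op_range_eq_0_iff by (simp only: Suc_eq_plus1)
    then have step: "bop_apply T ` op_range (T ^ q) = op_range (T ^ q)"
      by (simp only: op_range_power_Suc)
    have "op_range (T ^ (q + k)) = op_range (T ^ q)" for k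
      by (induction k) (simp_all only: add_Suc_right op_range_power_Suc step add.right_neutral)
    from this[of "N - q"] q(2) have "op_range (T ^ N) = op_range (T ^ q)" by simp
    then have "P q" using N by (simp add: bij P_def)
    then have "p \<le> q" unfolding p_def by (rule Least_le)
    have "weyl_on (op_range (T ^ p)) T"
      using weyl_on_op_range_iff[of T p N] p bijective_on_imp_weyl_on[OF N]
      by (simp add: P_def zero_enat_def)
    then have "Q p" using p(1) by (simp add: weyl_on_def P_def Q_def)
    then have "q \<le> p" unfolding q_def by (rule Least_le)
    with \<open>p \<le> q\<close> show "ascent T = descent T \<and> ascent T < \<infinity>"
      unfolding asc dsc INF_enat_eq_Least[of P, OF ex(1)] INF_enat_eq_Least[of Q, OF ex(2)]
      by (simp add: p_def q_def)
  qed
qed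

text \<open>
  The index is zero on some \<open>R(T\<^sup>m)\<close>, and a finite dimensional kernel allows it to be carried back to
  the whole space.
\<close>

lemma weyl_of_drazin_invertible:
  assumes "drazin_invertible T" "alpha T < \<infinity>"
  shows "weyl T"
proof -
  obtain m where "bijective_on (op_range (T ^ m)) T"
    using drazin_invertible_imp_bijective_on[OF assms(1)] by blast
  then have "weyl_on (op_range (T ^ m)) T" by (rule bijective_on_imp_weyl_on)
  moreover have "alpha_on (op_range (T ^ 0)) T < \<infinity>" using assms(2) by simp
  ultimately have "weyl_on (op_range (T ^ 0)) T" using weyl_on_op_range_iff by blast
  then show ?thesis by (simp add: weyl_iff_weyl_on)
qed

lemma browder_theorem_iff:
  fixes T :: "'a::complex_banach bop"
  shows "browder_theorem T \<longleftrightarrow> (\<forall>l. weyl (shift T l) \<longrightarrow> drazin_invertible (shift T l))"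
proof -
  have Pi0: "l \<in> Pi0_set T \<longleftrightarrow> drazin_invertible (shift T l) \<and> alpha (shift T l) < \<infinity>" for l
    unfolding Pi0_set_def Pi_set_def drazin_invertible_iff_bijective_on ascent_eq_descent_iff[symmetric]
    by blast
  have resolvent: "l \<in> Pi0_set T" if "l \<notin> spectrum T" for l
  proof -
    obtain S where S: "S * shift T l = 1" "shift T l * S = 1" using \<open>l \<notin> spectrum T\<close> by (auto simp: spectrum_def)
    have "drazin_invertible (shift T l)"
      unfolding drazin_invertible_def by (rule exI[of _ S], rule exI[of _ 0]) (simp add: S)
    moreover have "null_space (shift T l) \<subseteq> {0}"
    proof
      fix x assume "x \<in> null_space (shift T l)"
      then have "bop_apply (S * shift T l) x = 0" by (simp only: null_space_def bop_apply_algebra(1)) simp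
      then show "x \<in> {0}" by (simp add: S)
    qed
    ultimately show ?thesis by (simp add: Pi0 alpha_on_eq_0_iff[THEN iffD2] zero_enat_def)
  qed
  have "weyl (shift T l) \<Longrightarrow> alpha (shift T l) < \<infinity>" for l
    by (simp add: weyl_def fredholm_on_def)
  moreover have "browder_theorem T \<longleftrightarrow> (\<forall>l. weyl (shift T l) \<longleftrightarrow> l \<in> Pi0_set T)"
    unfolding browder_theorem_def weyl_spectrum_def using resolvent by blast
  ultimately show ?thesis using weyl_of_drazin_invertible unfolding Pi0 by blast
qed

lemma weyl_imp_b_weyl: "weyl T \<Longrightarrow> b_weyl T"
  unfolding b_weyl_iff by (intro exI[of _ 0]) (simp add: weyl_iff_weyl_on)

section \<open>Browder's theorem and B-Weyl operators\<close>

text \<open>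
  Modulo \<open>T(M)\<close> the operator \<open>T - \<mu>\<close> is multiplication by \<open>- \<mu>\<close>, hence bijective, so neither its kernel
  nor its cokernel changes on passing from \<open>M\<close> to \<open>T(M)\<close>.
\<close>

lemma weyl_on_image_shift:
  assumes M: "csubspace M" "bop_apply T ` M \<subseteq> M" and \<mu>: "\<mu> \<noteq> 0"
  shows "weyl_on (bop_apply T ` M) (shift T \<mu>) \<longleftrightarrow> weyl_on M (shift T \<mu>)"
proof -
  let ?S = "shift T \<mu>" and ?N = "bop_apply T ` M"
  have divide: "x \<in> ?N" if "\<mu> *\<^sub>C x \<in> ?N" for x
    using complex_vector.subspace_scale[OF csubspace_image[OF M(1), of T] that, of "inverse \<mu>"]
    by (simp only: scaleC_scaleC left_inverse[OF \<mu>] scaleC_one)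
  have S_M: "bop_apply ?S ` M \<subseteq> M"
  proof clarify
    fix x assume x: "x \<in> M"
    then have "bop_apply T x \<in> M" using M(2) by blast
    with x show "bop_apply ?S x \<in> M"
      by (simp add: complex_vector.subspace_diff[OF M(1)] complex_vector.subspace_scale[OF M(1)])
  qed
  have "null_space ?S \<inter> M \<subseteq> ?N"
  proof
    fix x assume "x \<in> null_space ?S \<inter> M"
    then have Tx: "bop_apply T x = \<mu> *\<^sub>C x" and x: "x \<in> M" by (auto simp: null_space_def)
    show "x \<in> ?N" by (rule divide) (use imageI[OF x, of "bop_apply T"] in \<open>simp only: Tx\<close>)
  qed
  then have "null_space ?S \<inter> ?N = null_space ?S \<inter> M" using M(2) by blast
  then have alpha: "alpha_on ?N ?S = alpha_on M ?S" by (simp add: alpha_on_def)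
  have "quotient_cdim ?N (bop_apply ?S ` ?N) = quotient_cdim M (bop_apply ?S ` M)"
  proof (rule quotient_cdim_image[of "\<lambda>x. x"])
    show "clinear (\<lambda>x::'a. x)" by (simp add: clinear_iff)
    show "(\<lambda>x. x) ` ?N \<subseteq> M" using M(2) by simp
    fix y assume y: "y \<in> M"
    then have "inverse \<mu> *\<^sub>C y \<in> M" using M(1) complex_vector.subspace_scale by blast
    moreover have "y - bop_apply T (inverse \<mu> *\<^sub>C y) = bop_apply ?S (- (inverse \<mu> *\<^sub>C y))"
      using \<mu> by (simp add: scaleC_minus_right scaleC_diff_right scaleC_scaleC scaleC_one)
    moreover have "- (inverse \<mu> *\<^sub>C y) \<in> M" using calculation(1) M(1) complex_vector.subspace_neg by blast
    ultimately show "\<exists>x\<in>?N. y - x \<in> bop_apply ?S ` M" by blast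
  next
    show "bop_apply ?S ` ?N = {x \<in> ?N. x \<in> bop_apply ?S ` M}"
    proof (intro equalityI subsetI)
      fix x assume "x \<in> bop_apply ?S ` ?N"
      then obtain y where y: "y \<in> M" "x = bop_apply ?S (bop_apply T y)" by auto
      then have "x = bop_apply T (bop_apply ?S y)" by simp
      then show "x \<in> {x \<in> ?N. x \<in> bop_apply ?S ` M}" using y M(2) S_M by blast
    next
      fix x assume "x \<in> {x \<in> ?N. x \<in> bop_apply ?S ` M}"
      then obtain y z where yz: "y \<in> M" "z \<in> M" "x = bop_apply T y" "x = bop_apply ?S z" by auto
      then have "\<mu> *\<^sub>C z = bop_apply T (z - y)" by (simp add: algebra_simps)
      moreover have "z - y \<in> M" using yz M(1) complex_vector.subspace_diff by blast
      ultimately have "\<mu> *\<^sub>C z \<in> ?N" by (rule image_eqI)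
      then have "z \<in> ?N" by (rule divide)
      then show "x \<in> bop_apply ?S ` ?N" using yz(4) by blast
    qed
  qed (use S_M csubspace_image[OF M(1)] M in blast)+
  with alpha show ?thesis by (simp add: weyl_on_def beta_on_def)
qed

lemma weyl_on_op_range_shift:
  assumes "\<mu> \<noteq> 0"
  shows "weyl_on (op_range (T ^ d)) (shift T \<mu>) \<longleftrightarrow> weyl (shift T \<mu>)"
proof (induction d)
  case 0
  then show ?case by (simp add: weyl_iff_weyl_on)
next
  case (Suc d)
  then show ?case
    using weyl_on_image_shift[OF csubspace_op_range op_range_power_invariant assms, of T d]
    by (simp only: op_range_power_Suc)
qed

text \<open>
  An eigenvector of \<open>T\<close> for \<open>\<nu> \<noteq> 0\<close> lies in \<open>R(T\<^sup>m)\<close>, where the bounded Drazin inverse \<open>S\<close> inverts \<open>T\<close>;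
  so \<open>x = \<nu> S x\<close>, which forces \<open>\<bar>\<nu>\<bar> norm S \<ge> 1\<close>.
\<close>

lemma drazin_invertible_no_small_eigenvalue:
  assumes "drazin_invertible T"
  shows "\<exists>e>0. \<forall>\<nu>. \<nu> \<noteq> 0 \<and> cmod \<nu> < e \<longrightarrow> null_space (shift T \<nu>) \<subseteq> {0}"
proof -
  obtain S m where S: "T ^ m = T ^ m * S * T" "T * S = S * T"
    using assms by (auto simp: drazin_invertible_def)
  define e where "e = 1 / (norm S + 1)"
  have e: "e > 0" unfolding e_def by (simp add: add_nonneg_pos)
  have "x = 0" if \<nu>: "\<nu> \<noteq> 0" "cmod \<nu> < e" and x: "x \<in> null_space (shift T \<nu>)" for \<nu> x
  proof -
    have Tx: "bop_apply T x = \<nu> *\<^sub>C x" using x by (simp add: null_space_def)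
    have pow: "bop_apply (T ^ k) x = \<nu> ^ k *\<^sub>C x" for k
      by (induction k) (simp_all add: Tx scaleC_scaleC scaleC_one mult.commute)
    have "T ^ m * S * T = S * T ^ m * T" using power_commuting_commutes[OF S(2), of m] by simp
    then have "bop_apply (T ^ m) x = bop_apply (S * T ^ m * T) x" using S(1) by simp
    then have "\<nu> ^ m *\<^sub>C x = \<nu> ^ m *\<^sub>C (\<nu> *\<^sub>C bop_apply S x)"
      by (simp add: pow Tx scaleC_scaleC mult.commute)
    then have "x = \<nu> *\<^sub>C bop_apply S x"
      by (rule complex_vector.scale_left_imp_eq[rotated]) (simp add: \<nu>(1))
    then have "norm x = cmod \<nu> * norm (bop_apply S x)" by (metis norm_scaleC)
    also have "\<dots> \<le> cmod \<nu> * (norm S * norm x)"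
      unfolding norm_bop.rep_eq by (intro mult_left_mono onorm bounded_linear_bop_apply) simp
    finally have le: "(1 - cmod \<nu> * norm S) * norm x \<le> 0" by (simp add: algebra_simps)
    have "cmod \<nu> * (norm S + 1) < 1"
      using \<nu>(2) by (simp add: e_def less_divide_eq add_nonneg_pos)
    then have "cmod \<nu> * norm S < 1" using norm_ge_zero[of \<nu>] unfolding distrib_left by linarith
    then show "x = 0" using le by (simp add: mult_le_0_iff)
  qed
  with e show ?thesis by blast
qed

text \<open>
  Applied to \<open>T = A - \<lambda>\<close>, this turns Browder's theorem, a statement about Weyl operators, into the same
  statement about B-Weyl operators.
\<close>

lemma b_weyl_imp_drazin_invertible_of_browder:
  fixes T :: "'a::complex_banach bop"
  assumes browder: "\<And>\<mu>. weyl (shift T \<mu>) \<Longrightarrow> drazin_invertible (shift T \<mu>)" and T: "b_weyl T"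
  shows "drazin_invertible T"
proof -
  define R where "R k = op_range (T ^ k)" for k
  have R: "csubspace (R k)" "bop_apply T ` R k \<subseteq> R k" for k
    by (auto simp: R_def intro: subsetD[OF op_range_power_invariant])
  have R_Suc: "R (Suc k) = bop_apply T ` R k" for k unfolding R_def by (rule op_range_power_Suc)
  have R_mono: "R k \<subseteq> R j" if "j \<le> k" for j k using that unfolding R_def by (rule op_range_power_antimono)
  obtain n where n: "closed (R n)" "weyl_on (R n) T" using T by (auto simp: b_weyl_iff R_def)
  have weyl: "weyl_on (R k) T" if "n \<le> k" for k
  proof -
    have "alpha_on (op_range (T ^ n)) T < \<infinity>" using n(2) unfolding weyl_on_def R_def by blast
    then show ?thesis using weyl_on_op_range_iff[OF _ that] n(2) unfolding R_def by blast
  qed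
  have closed: "closed (R k)" if "n \<le> k" for k
    using that
  proof (induction k rule: dec_induct)
    case (step k)
    have "quotient_cdim (R k) (bop_apply T ` R k) < \<infinity>"
      using weyl[OF step.hyps(1)] unfolding weyl_on_def beta_on_def by metis
    from finite_codim_range_closed[OF R(1) step.IH R(1) step.IH R(2) this]
    show ?case by (simp only: R_Suc)
  qed (rule n(1))
  \<comment> \<open>The kernels of \<open>T\<close> on the decreasing spaces \<open>R k\<close> stabilise once their dimension is minimal.\<close>
  obtain d where d: "n \<le> d" "\<And>k. n \<le> k \<Longrightarrow> the_enat (alpha_on (R d) T) \<le> the_enat (alpha_on (R k) T)"
    using ex_has_least_nat[of "\<lambda>k. n \<le> k" n "\<lambda>k. the_enat (alpha_on (R k) T)"] by auto
  obtain a where a: "alpha_on (R d) T = enat a" 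
    using weyl[OF d(1)] unfolding weyl_on_def by (metis less_infinityE)
  have stable: "null_space T \<inter> R d \<subseteq> R k" if k: "d \<le> k" for k
  proof -
    have "alpha_on (R k) T < \<infinity>" using weyl[OF order_trans[OF d(1) k]] unfolding weyl_on_def by blast
    then obtain b where b: "alpha_on (R k) T = enat b" by auto
    have "a \<le> b" using d(2)[of k] k d(1) a b by simp
    then have "quotient_cdim (null_space T \<inter> R d) (null_space T \<inter> R k) = 0"
      using alpha_on_subspace[OF R(1) R(1) R_mono[OF k], of T] a b
      by (cases "quotient_cdim (null_space T \<inter> R d) (null_space T \<inter> R k)") (auto simp: zero_enat_def)
    then show ?thesis using R(1) by (simp add: quotient_cdim_eq_0_iff)
  qed
  show ?thesis
  proof (cases "a = 0")
    case True
    then have "bijective_on (R d) T"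
      using weyl[OF d(1)] a by (simp add: bijective_on_def weyl_on_def zero_enat_def)
    then show ?thesis unfolding R_def by (rule bijective_on_imp_drazin_invertible)
  next
    case False
    \<comment> \<open>On this space \<open>T\<close> is onto and has the same kernel as on \<open>R d\<close>.\<close>
    define W where "W = (\<Inter>k\<in>{d..}. R k)"
    have W: "csubspace W" "closed W" "W \<subseteq> R d"
      using R(1) closed d(1) unfolding W_def csubspace_iff by (auto intro!: closed_INT)
    have TW: "bop_apply T ` W = W"
    proof
      show "bop_apply T ` W \<subseteq> W" unfolding W_def using R(2) by blast
      show "W \<subseteq> bop_apply T ` W"
      proof
        fix y assume y: "y \<in> W"
        have preimage: "\<exists>w\<in>R k. y = bop_apply T w" if "d \<le> k" for k
        proof -
          have "y \<in> R (Suc k)" using y that unfolding W_def by auto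
          then show ?thesis unfolding R_Suc by blast
        qed
        then obtain z where z: "z \<in> R d" "y = bop_apply T z" by blast
        have "z \<in> R k" if k: "d \<le> k" for k
        proof -
          obtain w where w: "w \<in> R k" "y = bop_apply T w" using preimage[OF k] by blast
          have "z - w \<in> null_space T \<inter> R d"
            using z w R_mono[OF k] complex_vector.subspace_diff[OF R(1)] by (auto simp: null_space_def)
          then have "z - w \<in> R k" using stable[OF k] by blast
          from complex_vector.subspace_add[OF R(1) this w(1)] show "z \<in> R k" by simp
        qed
        then have "z \<in> W" by (simp add: W_def)
        with z(2) show "y \<in> bop_apply T ` W" by blast
      qed
    qed
    have "null_space T \<inter> W = null_space T \<inter> R d" using stable W(3) by (auto simp: W_def)
    then have alphaW: "alpha_on W T = enat a" using a by (simp add: alpha_on_def)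
    have betaW: "quotient_cdim W (bop_apply T ` W) = 0" using W(1) TW by (simp add: quotient_cdim_eq_0_iff)
    obtain e1 where e1: "e1 > 0" "\<And>\<mu>. cmod \<mu> < e1 \<Longrightarrow>
        alpha_on W (shift T \<mu>) = enat a + quotient_cdim W (bop_apply (shift T \<mu>) ` W)"
    proof -
      have "alpha_on W T < \<infinity>" "quotient_cdim W (bop_apply T ` W) < \<infinity>"
        by (simp_all only: alphaW betaW) (simp_all add: zero_enat_def)
      from index_stable[OF W(1,2) W(1,2) equalityD1[OF TW] order_refl this]
      show thesis using that unfolding alphaW betaW add_0_right by blast
    qed
    \<comment> \<open>The index of \<open>T - \<mu>\<close> on \<open>W\<close> is \<open>a > 0\<close>.\<close>
    have eigen: "\<not> null_space (shift T \<mu>) \<subseteq> {0}" if "cmod \<mu> < e1" for \<mu>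
    proof
      assume "null_space (shift T \<mu>) \<subseteq> {0}"
      then have "alpha_on W (shift T \<mu>) = 0" using W(1) by (auto simp: alpha_on_eq_0_iff)
      with e1(2)[OF that] False show False by (simp add: enat_0_iff)
    qed
    have fin: "alpha_on (R d) T < \<infinity>" "quotient_cdim (R d) (bop_apply T ` R d) < \<infinity>"
      and index0: "quotient_cdim (R d) (bop_apply T ` R d) = enat a"
      using weyl[OF d(1)] a unfolding weyl_on_def beta_on_def by metis+
    obtain e2 where e2: "e2 > 0" "\<And>\<mu>. cmod \<mu> < e2 \<Longrightarrow> alpha_on (R d) (shift T \<mu>) < \<infinity> \<and>
        alpha_on (R d) (shift T \<mu>) + enat a = enat a + beta_on (R d) (shift T \<mu>)"
      using index_stable[OF R(1) closed[OF d(1)] R(1) closed[OF d(1)] R(2) order_refl fin]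
      unfolding a index0 beta_on_def by blast
    \<comment> \<open>Half of \<open>e1\<close> leaves room for the eigenvalues \<open>\<mu>0 + \<nu>\<close> of \<open>T\<close>, which are small nonzero eigenvalues \<open>\<nu>\<close>
      of \<open>T - \<mu>0\<close>.\<close>
    define \<mu>0 where "\<mu>0 = complex_of_real (min e1 e2 / 2)"
    have \<mu>0: "\<mu>0 \<noteq> 0" "cmod \<mu>0 < e2" "cmod \<mu>0 \<le> e1 / 2"
      using e1(1) e2(1) by (auto simp: \<mu>0_def min_def)
    have "weyl_on (R d) (shift T \<mu>0)"
      using e2(2)[OF \<mu>0(2)] unfolding weyl_on_def
      by (cases "beta_on (R d) (shift T \<mu>0)") auto
    then have "drazin_invertible (shift T \<mu>0)"
      by (intro browder) (simp only: R_def weyl_on_op_range_shift[OF \<mu>0(1)])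
    from drazin_invertible_no_small_eigenvalue[OF this] obtain e3 where e3: "e3 > 0"
      "\<And>\<nu>. \<nu> \<noteq> 0 \<Longrightarrow> cmod \<nu> < e3 \<Longrightarrow> null_space (shift (shift T \<mu>0) \<nu>) \<subseteq> {0}"
      by metis
    define \<nu> where "\<nu> = complex_of_real (min e1 e3 / 3)"
    have \<nu>: "\<nu> \<noteq> 0" "cmod \<nu> < e3" "cmod \<nu> < e1 / 2"
      using e1(1) e3(1) by (auto simp: \<nu>_def min_def)
    have "cmod (\<mu>0 + \<nu>) < e1" using norm_triangle_ineq[of \<mu>0 \<nu>] \<mu>0(3) \<nu>(3) by simp
    moreover have "shift (shift T \<mu>0) \<nu> = shift T (\<mu>0 + \<nu>)"
      by (rule bop_eqI) (simp add: scaleC_add_left)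
    ultimately have False using e3(2)[OF \<nu>(1,2)] eigen by simp
    then show ?thesis ..
  qed
qed

section \<open>Multiplication operators\<close>

text \<open>
  The idempotent \<open>e = s a\<close> equals both \<open>s\<^sup>m a\<^sup>m\<close> and \<open>a\<^sup>m s\<^sup>m\<close>, from which \<open>e c = e c e = c e\<close>; then \<open>a\<close> can
  be cancelled on the part where it is invertible.
\<close>

lemma drazin_inverse_commutes:
  fixes a b c :: "'r::monoid_mult"
  assumes s: "a ^ m = a ^ m * s * a" "s * a * s = s" "a * s = s * a" and c: "a * c = c * a"
  shows "s * c = c * s"
proof -
  define e where "e = s * a"
  have se: "e * s = s" "s * e = s" using s(2,3) by (simp_all add: e_def mult.assoc)
  have ae: "a * e = e * a" using s(3) by (simp add: e_def flip: mult.assoc)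
  have ee: "e * e = e" using se by (simp add: e_def flip: mult.assoc)
  have am: "a ^ m * e = a ^ m" "e * a ^ m = a ^ m"
    using s(1) power_commuting_commutes[OF ae, of m] by (simp_all add: e_def mult.assoc)
  have "s ^ k * a ^ k * e = e" for k
  proof (induction k)
    case (Suc k)
    have "s ^ Suc k * a ^ Suc k * e = s ^ k * (s * a) * (a ^ k * e)"
      by (simp only: power_Suc2[of s] power_Suc[of a] mult.assoc)
    also have "\<dots> = s ^ k * (e * a ^ k) * e" by (simp add: e_def mult.assoc)
    also have "e * a ^ k = a ^ k * e" using power_commuting_commutes[OF ae, of k] by simp
    also have "s ^ k * (a ^ k * e) * e = s ^ k * a ^ k * e" by (simp add: mult.assoc ee)
    finally show ?case using Suc by simp
  qed simp
  then have left: "e = s ^ m * a ^ m" by (metis am(1) mult.assoc)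
  have "s ^ m * a ^ m = a ^ m * s ^ m"
    using power_commuting_commutes[OF power_commuting_commutes[OF s(3)[symmetric], of m, symmetric], of m] by simp
  with left have right: "e = a ^ m * s ^ m" by simp
  have cm: "a ^ m * c = c * a ^ m" by (rule power_commuting_commutes[OF c])
  have "e * c = s ^ m * (a ^ m * c)" by (simp add: left mult.assoc)
  also have "\<dots> = s ^ m * (c * (a ^ m * e))" by (simp add: cm am(1))
  also have "\<dots> = s ^ m * (a ^ m * c) * e" by (simp add: cm mult.assoc)
  also have "\<dots> = e * c * e" by (simp add: left mult.assoc)
  finally have ec: "e * c = e * c * e" .
  have "c * e = (c * a ^ m) * s ^ m" by (simp add: right mult.assoc)
  also have "\<dots> = (e * a ^ m) * c * s ^ m" by (simp add: am(2) flip: cm)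
  also have "\<dots> = e * (c * a ^ m) * s ^ m" by (simp add: cm mult.assoc)
  also have "\<dots> = e * c * e" by (simp add: right mult.assoc)
  finally have ce: "e * c = c * e" using ec by simp
  have "s * c = s * (e * c)" by (simp add: se flip: mult.assoc)
  also have "\<dots> = s * (c * e)" by (simp only: ce)
  also have "\<dots> = s * c * (a * s)" by (simp only: e_def s(3) mult.assoc)
  also have "\<dots> = s * (a * c) * s" by (simp add: c mult.assoc)
  also have "\<dots> = (e * c) * s" by (simp add: e_def mult.assoc)
  also have "\<dots> = c * s" by (simp add: ce se mult.assoc)
  finally show ?thesis .
qed

lemma bop_add_apply: "bop_apply (S + T) x = bop_apply S x + bop_apply T x"
  by transfer simp

lemma bop_scaleC_algebra:
  fixes S T :: "'a::complex_normed_vector bop"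
  shows
  "(c *\<^sub>C S) * T = c *\<^sub>C (S * T)" "S * (c *\<^sub>C T) = c *\<^sub>C (S * T)"
  by (rule bop_eqI, simp)+

lemma left_mult_mult: "left_mult (A * B) = left_mult A * left_mult B"
  by (rule bop_eqI) (simp add: mult.assoc)

lemma right_mult_mult: "right_mult (A * B) = right_mult B * right_mult A"
  by (rule bop_eqI) (simp add: mult.assoc)

lemma left_mult_1 [simp]: "left_mult 1 = 1" and right_mult_1 [simp]: "right_mult 1 = 1"
  by (rule bop_eqI, simp)+

lemma left_mult_power: "left_mult (A ^ n) = left_mult A ^ n"
  by (induction n) (simp_all add: left_mult_mult)

lemma right_mult_power: "right_mult (A ^ n) = right_mult A ^ n"
  by (induction n) (simp_all add: right_mult_mult power_commutes)

lemma left_mult_eq_iff [simp]: "left_mult A = left_mult B \<longleftrightarrow> A = B"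
  by (metis left_mult_apply mult.right_neutral)

lemma right_mult_eq_iff [simp]: "right_mult A = right_mult B \<longleftrightarrow> A = B"
  by (metis right_mult_apply mult.left_neutral)

lemma shift_left_mult: "shift (left_mult A) l = left_mult (shift A l)"
  by (rule bop_eqI) (simp add: shift_def left_diff_distrib bop_scaleC_algebra)

lemma shift_right_mult: "shift (right_mult A) l = right_mult (shift A l)"
  by (rule bop_eqI) (simp add: shift_def right_diff_distrib bop_scaleC_algebra)

text \<open>
  The Drazin inverse \<open>S\<close> of \<open>L\<^sub>A\<close> commutes with every \<open>R\<^sub>T\<close>, so \<open>S T = S (R\<^sub>T 1) = (S 1) T\<close>.
\<close>

lemma drazin_invertible_left_mult_iff: "drazin_invertible (left_mult A) \<longleftrightarrow> drazin_invertible A"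
proof
  assume "drazin_invertible (left_mult A)"
  then obtain S m where S: "left_mult A ^ m = left_mult A ^ m * S * left_mult A"
    "S * left_mult A * S = S" "left_mult A * S = S * left_mult A"
    by (auto simp: drazin_invertible_def)
  have "S = left_mult (bop_apply S 1)"
  proof (rule bop_eqI)
    fix T
    have "left_mult A * right_mult T = right_mult T * left_mult A"
      by (rule bop_eqI) (simp add: mult.assoc)
    then have "S * right_mult T = right_mult T * S" by (rule drazin_inverse_commutes[OF S])
    then have "bop_apply (S * right_mult T) 1 = bop_apply (right_mult T * S) 1" by simp
    then show "bop_apply S T = bop_apply (left_mult (bop_apply S 1)) T" by simp
  qed
  then obtain B where "S = left_mult B" ..
  with S show "drazin_invertible A"
    unfolding drazin_invertible_def
    by (metis left_mult_eq_iff left_mult_mult left_mult_power)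
next
  assume "drazin_invertible A"
  then show "drazin_invertible (left_mult A)"
    unfolding drazin_invertible_def by (metis left_mult_mult left_mult_power)
qed

lemma drazin_invertible_right_mult_iff: "drazin_invertible (right_mult A) \<longleftrightarrow> drazin_invertible A"
proof
  assume "drazin_invertible (right_mult A)"
  then obtain S m where S: "right_mult A ^ m = right_mult A ^ m * S * right_mult A"
    "S * right_mult A * S = S" "right_mult A * S = S * right_mult A"
    by (auto simp: drazin_invertible_def)
  have "S = right_mult (bop_apply S 1)"
  proof (rule bop_eqI)
    fix T
    have "right_mult A * left_mult T = left_mult T * right_mult A"
      by (rule bop_eqI) (simp add: mult.assoc)
    then have "S * left_mult T = left_mult T * S" by (rule drazin_inverse_commutes[OF S])
    then have "bop_apply (S * left_mult T) 1 = bop_apply (left_mult T * S) 1" by simp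
    then show "bop_apply S T = bop_apply (right_mult (bop_apply S 1)) T" by simp
  qed
  then obtain B where B: "S = right_mult B" ..
  \<comment> \<open>Right multiplication reverses products, so the factors have to be put back in order.\<close>
  have "A ^ m = A ^ m * B * A"
  proof -
    have "right_mult (A ^ m) = right_mult (A * (B * A ^ m))"
      using S(1) by (simp add: B right_mult_mult right_mult_power mult.assoc)
    then have eq: "A ^ m = A * (B * A ^ m)" by simp
    have "right_mult (A * B) = right_mult (B * A)" using S(3) by (simp add: B right_mult_mult)
    then have comm: "A * B = B * A" by simp
    have "A ^ m * (A * B) = (A * B) * A ^ m"
      by (rule power_commuting_commutes) (metis comm mult.assoc)
    also have "\<dots> = A ^ m" using eq by (simp only: mult.assoc)
    finally show ?thesis by (simp only: comm mult.assoc)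
  qed
  moreover have "B * A * B = B"
    using S(2) unfolding B right_mult_mult[symmetric] right_mult_eq_iff by (simp add: mult.assoc)
  moreover have "A * B = B * A"
    using S(3) unfolding B right_mult_mult[symmetric] right_mult_eq_iff by simp
  ultimately show "drazin_invertible A" unfolding drazin_invertible_def by blast
next
  assume "drazin_invertible A"
  then obtain B m where B: "A ^ m = A ^ m * B * A" "B * A * B = B" "A * B = B * A"
    by (auto simp: drazin_invertible_def)
  have "A ^ m = A * B * A ^ m"
  proof -
    have "A ^ m * (A * B) = (A * B) * A ^ m"
      by (rule power_commuting_commutes) (metis B(3) mult.assoc)
    with B(1) show ?thesis by (simp only: B(3) mult.assoc)
  qed
  then have "right_mult (A ^ m) = right_mult (A * B * A ^ m)" by (rule arg_cong)
  then have "right_mult A ^ m = right_mult A ^ m * right_mult B * right_mult A"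
    by (simp only: right_mult_mult right_mult_power mult.assoc)
  moreover have "right_mult B * right_mult A * right_mult B = right_mult B"
    using B(2) by (metis right_mult_mult mult.assoc)
  moreover have "right_mult A * right_mult B = right_mult B * right_mult A"
    using B(3) by (metis right_mult_mult)
  ultimately show "drazin_invertible (right_mult A)" unfolding drazin_invertible_def by blast
qed

lemma cdim_finite_iff:
  assumes "csubspace V"
  shows "cdim V < \<infinity> \<longleftrightarrow> (\<exists>B. finite B \<and> V \<subseteq> cspan B)"
proof
  assume "cdim V < \<infinity>"
  then obtain B where B: "quotient_basis V {0} B"
    using quotient_cdim_infinite_iff cdim_eq_quotient_cdim[OF assms] by force
  then have "V \<subseteq> cspan B" using quotient_basis_spanning[OF B] by auto
  with B show "\<exists>B. finite B \<and> V \<subseteq> cspan B" by (auto simp: quotient_basis_def)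
next
  assume "\<exists>B. finite B \<and> V \<subseteq> cspan B"
  then obtain B where "finite B" "V \<subseteq> cspan B" by blast
  then have "\<exists>B. quotient_basis V {0} B" by (intro quotient_basis_exists[of _ B]) auto
  then show "cdim V < \<infinity>"
    unfolding cdim_eq_quotient_cdim[OF assms] using quotient_cdim_infinite_iff by force
qed

definition rank_one :: "'a::complex_normed_vector \<Rightarrow> ('a \<Rightarrow> complex) \<Rightarrow> 'a bop" where
  "rank_one v \<phi> = Bop (\<lambda>x. \<phi> x *\<^sub>C v)"

lemma rank_one_apply:
  assumes "cfunctional \<phi>"
  shows "bop_apply (rank_one v \<phi>) x = \<phi> x *\<^sub>C v"
proof -
  have \<phi>: "bounded_linear \<phi>" "\<And>c x. \<phi> (c *\<^sub>C x) = c * \<phi> x" using assms by (auto simp: cfunctional_def)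
  have "bounded_linear (\<lambda>c. c *\<^sub>C v)"
    by (rule bounded_linear_intro[of _ "norm v"])
      (simp_all add: scaleC_add_left scaleR_scaleC scaleC_scaleC norm_scaleC scaleR_conv_of_real)
  then have "bounded_clinear (\<lambda>x. \<phi> x *\<^sub>C v)"
    unfolding bounded_clinear_def
    using bounded_linear_compose[OF _ \<phi>(1)] by (auto simp: \<phi>(2) scaleC_scaleC)
  then show ?thesis by (simp add: rank_one_def Bop_inverse)
qed

text \<open>
  If \<open>S x \<noteq> 0\<close>, the operators \<open>R S\<close> with \<open>R\<close> of rank one take every value at \<open>x\<close>, so evaluation at \<open>x\<close>
  maps the ideal onto the whole space.
\<close>

lemma left_ideal_infinite_dim:
  fixes V :: "'a::complex_normed_vector bop set"
  assumes inf: "cdim (UNIV :: 'a set) = \<infinity>" and V: "csubspace V"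
    and S: "S \<in> V" "S \<noteq> 0" and ideal: "\<And>R. R * S \<in> V"
  shows "cdim V = \<infinity>"
proof (rule ccontr)
  assume "cdim V \<noteq> \<infinity>"
  then obtain B where B: "finite B" "V \<subseteq> cspan B" using cdim_finite_iff[OF V] by auto
  obtain x where x: "bop_apply S x \<noteq> 0" using S(2) bop_eqI[of S 0] by auto
  then obtain \<phi> where \<phi>: "cfunctional \<phi>" "\<phi> (bop_apply S x) = 1"
    using functional_separates by blast
  have ev: "clinear (\<lambda>T. bop_apply T x)"
    by (simp add: clinear_iff bop_add_apply)
  have "v \<in> cspan ((\<lambda>T. bop_apply T x) ` B)" for v
  proof -
    have "bop_apply (rank_one v \<phi> * S) x = v" using \<phi> by (simp add: rank_one_apply scaleC_one)
    moreover have "rank_one v \<phi> * S \<in> cspan B" using ideal B by blast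
    ultimately have "v \<in> (\<lambda>T. bop_apply T x) ` cspan B" 
      by (intro image_eqI[where x = "rank_one v \<phi> * S"]) simp_all
    then show ?thesis by (simp only: complex_vector_pair.linear_span_image[OF ev])
  qed
  then have "UNIV \<subseteq> cspan ((\<lambda>T. bop_apply T x) ` B)" by blast
  then have "cdim (UNIV :: 'a set) < \<infinity>"
    using finite_imageI[OF B(1)] by (subst cdim_finite_iff) auto
  with inf show False by simp
qed

lemma finite_codim_joint_kernel:
  fixes f :: "'i \<Rightarrow> 'a::complex_normed_vector \<Rightarrow> complex"
  assumes "finite I" and lin: "\<And>i x y. f i (x + y) = f i x + f i y" "\<And>i c x. f i (c *\<^sub>C x) = c * f i x"
  shows "csubspace {x. \<forall>i\<in>I. f i x = 0} \<and> quotient_cdim UNIV {x. \<forall>i\<in>I. f i x = 0} < \<infinity>"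
  using assms(1)
proof (induction I rule: finite_induct)
  case empty
  then show ?case by (simp add: quotient_cdim_eq_0_iff[THEN iffD2] zero_enat_def)
next
  case (insert i I)
  define K where "K = {x. \<forall>i\<in>I. f i x = 0}"
  define K' where "K' = {x. \<forall>i\<in>insert i I. f i x = 0}"
  have zero: "f j 0 = 0" for j using lin(2)[of j 0 0] by simp
  have sub: "csubspace K" "csubspace K'" "K' \<subseteq> K"
    by (auto simp: K_def K'_def csubspace_iff lin zero)
  have "\<exists>B. quotient_basis K K' B"
  proof (cases "\<exists>k\<in>K. f i k \<noteq> 0")
    case True
    then obtain k where k: "k \<in> K" "f i k \<noteq> 0" by blast
    have diff: "f j (x - y) = f j x - f j y" for j x y using lin(1)[of j "x - y" y] by simp
    have "x - (f i x / f i k) *\<^sub>C k \<in> K'" if "x \<in> K" for x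
      using that k by (auto simp: K_def K'_def lin(2) diff)
    then show ?thesis
      using complex_vector.span_scale[OF complex_vector.span_base[of k "{k}"]]
      by (intro quotient_basis_exists[OF sub(2), of "{k}"]) blast+
  next
    case False
    then have "K \<subseteq> K'" by (auto simp: K_def K'_def)
    then show ?thesis by (intro exI[of _ "{}"]) (auto simp: quotient_basis_def)
  qed
  then have "quotient_cdim K K' \<noteq> \<infinity>" by (simp add: quotient_cdim_infinite_iff)
  moreover have "quotient_cdim UNIV K \<noteq> \<infinity>" using insert.IH by (auto simp: K_def)
  ultimately have "quotient_cdim UNIV K' < \<infinity>"
    using quotient_cdim_add[of UNIV K K'] sub by auto
  then show ?case using sub(2) by (simp only: K'_def)
qed

text \<open>
  With \<open>\<psi> (S u) = 1\<close>, the functionals \<open>\<psi> \<circ> T\<close> for \<open>T\<close> in the ideal include every bounded functional, since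
  \<open>T\<close> may be \<open>S\<close> times an operator of rank one.  If finitely many of them spanned the others, their
  joint kernel would be zero by the Hahn-Banach theorem, and of finite codimension.
\<close>

lemma right_ideal_infinite_dim:
  fixes V :: "'a::complex_normed_vector bop set"
  assumes inf: "cdim (UNIV :: 'a set) = \<infinity>" and V: "csubspace V"
    and S: "S \<in> V" "S \<noteq> 0" and ideal: "\<And>R. S * R \<in> V"
  shows "cdim V = \<infinity>"
proof (rule ccontr)
  assume "cdim V \<noteq> \<infinity>"
  then obtain B where B: "finite B" "V \<subseteq> cspan B" using cdim_finite_iff[OF V] by auto
  obtain u where "bop_apply S u \<noteq> 0" using S(2) bop_eqI[of S 0] by auto
  then obtain \<psi> where \<psi>: "cfunctional \<psi>" "\<psi> (bop_apply S u) = 1"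
    using functional_separates by blast
  then have bl: "bounded_linear \<psi>" and hom: "\<And>c x. \<psi> (c *\<^sub>C x) = c * \<psi> x"
    by (auto simp: cfunctional_def)
  note \<psi>_simps = linear_simps[OF bl] hom
  define K where "K = {x. \<forall>T\<in>B. \<psi> (bop_apply T x) = 0}"
  have "quotient_cdim UNIV K < \<infinity>"
    unfolding K_def using finite_codim_joint_kernel[OF B(1), of "\<lambda>T x. \<psi> (bop_apply T x)"]
    by (simp add: \<psi>_simps)
  moreover have "K = {0}"
  proof
    show "K \<subseteq> {0}"
    proof
      fix x assume x: "x \<in> K"
      have "csubspace {T. \<psi> (bop_apply T x) = 0}"
        by (simp add: csubspace_iff bop_add_apply \<psi>_simps)
      moreover have "B \<subseteq> {T. \<psi> (bop_apply T x) = 0}" using x by (auto simp: K_def)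
      ultimately have "cspan B \<subseteq> {T. \<psi> (bop_apply T x) = 0}" by (rule complex_vector.span_minimal[rotated])
      then have vanish: "\<psi> (bop_apply T x) = 0" if "T \<in> V" for T using B(2) that by blast
      show "x \<in> {0}"
      proof (rule ccontr)
        assume "x \<notin> {0}"
        then obtain \<phi> where \<phi>: "cfunctional \<phi>" "\<phi> x = 1" using functional_separates[of x] by auto
        then have "\<psi> (bop_apply (S * rank_one u \<phi>) x) = 1"
          using \<psi>(2) by (simp add: rank_one_apply scaleC_one)
        with vanish[OF ideal] show False by simp
      qed
    qed
  qed (simp add: K_def \<psi>_simps)
  ultimately have "cdim (UNIV :: 'a set) < \<infinity>" by (simp add: cdim_eq_quotient_cdim)
  with inf show False by simp
qed

text \<open>
  B-Weyl means that kernel and cokernel on some \<open>R(L\<^sup>n)\<close> have equal finite dimension, which must then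
  be zero.
\<close>

lemma b_weyl_imp_drazin_if_kernels_zero_or_infinite:
  fixes L :: "'a::complex_banach bop"
  assumes "\<And>n. alpha_on (op_range (L ^ n)) L < \<infinity> \<Longrightarrow> alpha_on (op_range (L ^ n)) L = 0" and "b_weyl L"
  shows "drazin_invertible L"
proof -
  obtain n where "weyl_on (op_range (L ^ n)) L" using assms(2) by (auto simp: b_weyl_iff)
  then have "alpha_on (op_range (L ^ n)) L < \<infinity>"
    and "alpha_on (op_range (L ^ n)) L = beta_on (op_range (L ^ n)) L"
    unfolding weyl_on_def by blast+
  with assms(1)[of n] have "bijective_on (op_range (L ^ n)) L"
    unfolding bijective_on_def by metis
  then show ?thesis by (rule bijective_on_imp_drazin_invertible)
qed

lemma b_weyl_left_mult_iff:
  fixes A :: "'a::complex_banach bop"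
  assumes inf: "cdim (UNIV :: 'a set) = \<infinity>"
  shows "b_weyl (left_mult A) \<longleftrightarrow> drazin_invertible (left_mult A)"
proof
  assume "b_weyl (left_mult A)"
  then show "drazin_invertible (left_mult A)"
  proof (rule b_weyl_imp_drazin_if_kernels_zero_or_infinite[rotated])
    fix n
    let ?V = "null_space (left_mult A) \<inter> op_range (left_mult A ^ n)"
    assume fin: "alpha_on (op_range (left_mult A ^ n)) (left_mult A) < \<infinity>"
    have ideal: "S * R \<in> ?V" if S: "S \<in> ?V" for S R
    proof -
      obtain U where U: "S = A ^ n * U" using S by (auto simp: op_range_def simp flip: left_mult_power)
      have "A * S = 0" using S by (simp add: null_space_def)
      then have "A * (S * R) = 0" by (simp flip: mult.assoc)
      moreover have "S * R = bop_apply (left_mult A ^ n) (U * R)"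
        by (simp add: U mult.assoc flip: left_mult_power)
      ultimately show ?thesis unfolding null_space_def op_range_def by auto
    qed
    have "S = 0" if "S \<in> ?V" for S
      using right_ideal_infinite_dim[OF inf _ that _ ideal[OF that]] fin
      by (fastforce simp: alpha_on_def)
    then show "alpha_on (op_range (left_mult A ^ n)) (left_mult A) = 0"
      by (auto simp: alpha_on_eq_0_iff)
  qed
qed (rule drazin_invertible_imp_b_weyl)

lemma b_weyl_right_mult_iff:
  fixes A :: "'a::complex_banach bop"
  assumes inf: "cdim (UNIV :: 'a set) = \<infinity>"
  shows "b_weyl (right_mult A) \<longleftrightarrow> drazin_invertible (right_mult A)"
proof
  assume "b_weyl (right_mult A)"
  then show "drazin_invertible (right_mult A)"
  proof (rule b_weyl_imp_drazin_if_kernels_zero_or_infinite[rotated])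
    fix n
    let ?V = "null_space (right_mult A) \<inter> op_range (right_mult A ^ n)"
    assume fin: "alpha_on (op_range (right_mult A ^ n)) (right_mult A) < \<infinity>"
    have ideal: "R * S \<in> ?V" if S: "S \<in> ?V" for S R
    proof -
      obtain U where U: "S = U * A ^ n" using S by (auto simp: op_range_def simp flip: right_mult_power)
      have "S * A = 0" using S by (simp add: null_space_def)
      then have "R * S * A = 0" by (simp add: mult.assoc)
      moreover have "R * S = bop_apply (right_mult A ^ n) (R * U)"
        by (simp add: U mult.assoc flip: right_mult_power)
      ultimately show ?thesis unfolding null_space_def op_range_def by auto
    qed
    have "S = 0" if "S \<in> ?V" for S
      using left_ideal_infinite_dim[OF inf _ that _ ideal[OF that]] fin
      by (fastforce simp: alpha_on_def)
    then show "alpha_on (op_range (right_mult A ^ n)) (right_mult A) = 0"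
      by (auto simp: alpha_on_eq_0_iff)
  qed
qed (rule drazin_invertible_imp_b_weyl)

section \<open>The multiplication operators of an operator on an infinite dimensional space\<close>

theorem theorem3p2:
  fixes A :: "'a::complex_banach bop"
  assumes "cdim (UNIV :: 'a set) = \<infinity>"
  shows "browder_theorem (left_mult A) \<and>
    browder_theorem (right_mult A) \<and>
    (b_weyl_spectrum A \<subseteq> b_weyl_spectrum (left_mult A) \<and>
      b_weyl_spectrum (left_mult A) = drazin_spectrum (left_mult A) \<and>
      drazin_spectrum (left_mult A) = drazin_spectrum A) \<and>
    (b_weyl_spectrum A \<subseteq> b_weyl_spectrum (right_mult A) \<and>
      b_weyl_spectrum (right_mult A) = drazin_spectrum (right_mult A) \<and>
      drazin_spectrum (right_mult A) = drazin_spectrum A) \<and>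
    (b_weyl_spectrum (left_mult A) = b_weyl_spectrum A \<longleftrightarrow> browder_theorem A) \<and>
    (b_weyl_spectrum (right_mult A) = b_weyl_spectrum A \<longleftrightarrow> browder_theorem A)"
proof -
  have left: "b_weyl (shift (left_mult A) l) \<longleftrightarrow> drazin_invertible (shift A l)"
    "drazin_invertible (shift (left_mult A) l) \<longleftrightarrow> drazin_invertible (shift A l)" for l
    by (simp_all add: shift_left_mult b_weyl_left_mult_iff[OF assms] drazin_invertible_left_mult_iff)
  have right: "b_weyl (shift (right_mult A) l) \<longleftrightarrow> drazin_invertible (shift A l)"
    "drazin_invertible (shift (right_mult A) l) \<longleftrightarrow> drazin_invertible (shift A l)" for l
    by (simp_all add: shift_right_mult b_weyl_right_mult_iff[OF assms] drazin_invertible_right_mult_iff)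
  have "browder_theorem (left_mult A)" "browder_theorem (right_mult A)"
    unfolding browder_theorem_iff using weyl_imp_b_weyl left right by blast+
  moreover have "b_weyl_spectrum A \<subseteq> drazin_spectrum A"
    using drazin_invertible_imp_b_weyl by (auto simp: b_weyl_spectrum_def drazin_spectrum_def)
  moreover have "b_weyl_spectrum (left_mult A) = drazin_spectrum A"
    "drazin_spectrum (left_mult A) = drazin_spectrum A"
    "b_weyl_spectrum (right_mult A) = drazin_spectrum A"
    "drazin_spectrum (right_mult A) = drazin_spectrum A"
    by (simp_all add: b_weyl_spectrum_def drazin_spectrum_def left right)
  moreover have "drazin_spectrum A = b_weyl_spectrum A \<longleftrightarrow> browder_theorem A"
  proof
    assume "drazin_spectrum A = b_weyl_spectrum A"
    then have "b_weyl (shift A l) \<longleftrightarrow> drazin_invertible (shift A l)" for l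
      by (auto simp: b_weyl_spectrum_def drazin_spectrum_def)
    then show "browder_theorem A" unfolding browder_theorem_iff using weyl_imp_b_weyl by blast
  next
    assume A: "browder_theorem A"
    have "drazin_invertible (shift A l)" if l: "b_weyl (shift A l)" for l
    proof (rule b_weyl_imp_drazin_invertible_of_browder[OF _ l])
      fix \<mu>
      have "shift (shift A l) \<mu> = shift A (l + \<mu>)" by (rule bop_eqI) (simp add: scaleC_add_left)
      then show "weyl (shift (shift A l) \<mu>) \<Longrightarrow> drazin_invertible (shift (shift A l) \<mu>)"
        using A by (simp add: browder_theorem_iff)
    qed
    with drazin_invertible_imp_b_weyl show "drazin_spectrum A = b_weyl_spectrum A"
      unfolding b_weyl_spectrum_def drazin_spectrum_def by blast
  qed
  ultimately show ?thesis by simp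
qed

end
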